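(* For each $d\ge1$ let $p_d$ be a monic polynomial of degree $d$ all of whose roots are non-negative real numbers, with multiset of roots $\Lambda_d=\{\lambda_{1,d}\ge\dots\ge\lambda_{d,d}\}$. Let $\mu_d=\frac1d\sum_{i=1}^d\delta_{\lambda_{i,d}}$ and $\nu_d=\frac1d\sum_{i=1}^d\delta_{R_i(\Lambda_d)}$. Assume that there exist a compactly supported probability measure $\mu$ on $[0,\infty)$ and a compact set $K\subset[0,\infty)$ such that $\mu$ and all the measures $\mu_d$ ($d\ge1$) are supported on $K$, and such that $\mu_d$ converges weakly to $\mu$ as $d\to\infty$. Then $$R_1(\Lambda_d)\to\int_0^\infty t\,\mu(\mathrm{d}t)\qquad\text{as } d\to\infty.$$ If in addition $0\notin K$, then, as $d\to\infty$, $$R_d(\Lambda_d)\to\left(\int_0^\infty t^{-1}\,\mu(\mathrm{d}t)\right)^{-1}\qquad\text{and}\qquad\int_0^\infty(\log t)\,\nu_d(\mathrm{d}t)\to\int_0^\infty(\log t)\,\Phi(\mu)(\mathrm{d}t).$$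
   Context: For a finite multiset $\Lambda=\{\lambda_1,\dots,\lambda_d\}$ of complex numbers, $e_i(\Lambda):=\sum_{J\subset\{1,\dots,d\},\,|J|=i}\prod_{j\in J}\lambda_j$, $e_0(\Lambda):=1$, and $\widetilde e_i(\Lambda):=e_i(\Lambda)/\binom di$ for $0\le i\le d$. If $\Lambda_d$ is the multiset of (non-negative real) roots of a monic polynomial $p_d$ of degree $d$ and $k_d$ is the number of zeros in $\Lambda_d$ (with multiplicity), then $$R_i(\Lambda_d):=\frac{\widetilde e_i(\Lambda_d)}{\widetilde e_{i-1}(\Lambda_d)}\quad(1\le i\le d-k_d),\qquad R_i(\Lambda_d):=0\quad(d-k_d+1\le i\le d).$$ (These numbers are the limits, as $n\to\infty$, of the $n$-th roots of the decreasingly ordered roots of the $n$-th power $p_d^{\boxtimes_d n}$ of $p_d$, where $\boxtimes_d$ is the finite free multiplicative convolution: for $p(x)=\sum_{i=0}^d(-1)^ip_ix^{d-i}$ and $q(x)=\sum_{i=0}^d(-1)^iq_ix^{d-i}$, $(p\boxtimes_dq)(x)=\sum_{i=0}^d(-1)^i\frac{p_iq_i}{\binom di}x^{d-i}$.) S-transform and free multiplicative convolution: for a probability measure $\mu\ne\delta_0$ on $[0,\infty)$ let $\psi_\mu(z)=\int_0^\infty\frac{tz}{1-tz}\,\mu(\mathrm{d}t)$ for $z\in\mathbb{C}\setminus[0,\infty)$. The function $\psi_\mu$ restricted to $(-\infty,0)$ is invertible onto $(\mu(\{0\})-1,0)$, and the S-transform is $S_\mu(z)=\frac{z+1}{z}\psi_\mu^{-1}(z)$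 for $z\in(\mu(\{0\})-1,0)$. For probability measures $\mu,\nu\neq\delta_0$ on $[0,\infty)$, the free multiplicative convolution $\mu\boxtimes\nu$ is the probability measure on $[0,\infty)$ characterized by $S_{\mu\boxtimes\nu}(z)=S_\mu(z)S_\nu(z)$ on the common interval where all three S-transforms are defined; $\mu^{\boxtimes n}$ is the $n$-th power under $\boxtimes$. For $\alpha>0$, $\mu^{\alpha}$ denotes the push-forward of $\mu$ under $x\mapsto x^\alpha$. The measure $\Phi(\mu)$: for a probability measure $\mu$ on $[0,\infty)$, $\Phi(\mu)$ denotes the weak limit of $\big(\mu^{\boxtimes n}\big)^{1/n}$ as $n\to\infty$, which is known to exist (Tucci; Haagerup–Möller). When $\mu$ is not a Dirac mass, it is known to be the probability measure on $[0,\infty)$ characterized by $\Phi(\mu)\big([0,\tfrac1{S_\mu(t-1)}]\big)=t$ for $t\in(\mu(\{0\}),1)$ and $\Phi(\mu)(\{0\})=\mu(\{0\})$; when $\mu=\delta_a$ one has $\Phi(\delta_a)=\delta_a$. *)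

theory Defs
  imports "HOL-Probability.Probability" "HOL-Computational_Algebra.Polynomial"
begin

section \<open>Elementary symmetric functions and the numbers $R_i$\<close>

text \<open>
  A multiset with \<open>d\<close> elements is given by an enumeration \<open>x 1, \<dots>, x d\<close>; values of \<open>x\<close> outside
  \<open>{1..d}\<close> are ignored.  None of the notions below depends on the order of the enumeration.
\<close>

definition esym :: "nat \<Rightarrow> (nat \<Rightarrow> 'a::comm_semiring_1) \<Rightarrow> nat \<Rightarrow> 'a" where
  "esym d x i = (\<Sum>J | J \<subseteq> {1..d} \<and> card J = i. \<Prod>j\<in>J. x j)"

definition esym_normalized :: "nat \<Rightarrow> (nat \<Rightarrow> 'a::field_char_0) \<Rightarrow> nat \<Rightarrow> 'a" where
  "esym_normalized d x i = esym d x i / of_nat (d choose i)"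

definition zero_count :: "nat \<Rightarrow> (nat \<Rightarrow> 'a::zero) \<Rightarrow> nat" where
  "zero_count d x = card {j \<in> {1..d}. x j = 0}"

text \<open>Only meaningful for \<open>1 \<le> i \<le> d\<close>.\<close>

definition R_ratio :: "nat \<Rightarrow> (nat \<Rightarrow> 'a::field_char_0) \<Rightarrow> nat \<Rightarrow> 'a" where
  "R_ratio d x i =
     (if i \<le> d - zero_count d x
      then esym_normalized d x i / esym_normalized d x (i - 1) else 0)"

section \<open>Measures\<close>

text \<open>
  For a closed set \<open>S\<close>, a Borel probability measure on \<open>\<real>\<close> gives mass 1 to \<open>S\<close> iff its support
  is contained in \<open>S\<close>.
\<close>

definition prob_measure_on :: "real set \<Rightarrow> real measure \<Rightarrow> bool" where
  "prob_measure_on S M \<longleftrightarrow> real_distribution M \<and> measure M S = 1"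

text \<open>
  The measure $\frac1d\sum_{i=1}^d \delta_{x_i}$ (for \<open>d \<ge> 1\<close>), as the law of \<open>x i\<close> for \<open>i\<close>
  uniformly distributed on \<open>{1..d}\<close>.
\<close>

definition empirical_measure :: "nat \<Rightarrow> (nat \<Rightarrow> real) \<Rightarrow> real measure" where
  "empirical_measure d x = distr (measure_pmf (pmf_of_set {1..d})) borel x"

abbreviation dirac_zero :: "real measure" where
  "dirac_zero \<equiv> return borel 0"

text \<open>The push-forward of a measure on \<open>[0, \<infinity>)\<close> under $x \mapsto x^\alpha$, for \<open>\<alpha> > 0\<close>.\<close>

definition pushforward_powr :: "real measure \<Rightarrow> real \<Rightarrow> real measure" where
  "pushforward_powr M \<alpha> = distr M borel (\<lambda>x. x powr \<alpha>)"

section \<open>S-transform and free multiplicative convolution\<close>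

text \<open>
  The type \<open>'a\<close> is \<open>complex\<close> for the moment transform on $\mathbb{C} \setminus [0,\infty)$, and
  \<open>real\<close> for its restriction to the negative half-line, which is what the S-transform uses.
\<close>

definition psi_transform ::
  "real measure \<Rightarrow> 'a \<Rightarrow> 'a::{real_normed_field, banach, second_countable_topology}" where
  "psi_transform M z = (LINT t|M. of_real t * z / (1 - of_real t * z))"

text \<open>Only meaningful for \<open>M \<noteq> dirac_zero\<close> and \<open>z\<close> in the interval \<open>S_domain M\<close>.\<close>

definition S_transform :: "real measure \<Rightarrow> real \<Rightarrow> real" where
  "S_transform M z = (z + 1) / z * the_inv_into {..<0} (psi_transform M) z"

definition S_domain :: "real measure \<Rightarrow> real set" where
  "S_domain M = {measure M {0} - 1 <..< 0}"

text \<open>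
  \<open>is_free_mult_conv M N L\<close> says that $L = M \boxtimes N$.  The convolution is a relation here, so
  that its existence (a known theorem) is not built into the definition.  The measure \<open>dirac_zero\<close>
  has no S-transform and is absorbing, by the usual convention.
\<close>

definition is_free_mult_conv :: "real measure \<Rightarrow> real measure \<Rightarrow> real measure \<Rightarrow> bool" where
  "is_free_mult_conv M N L \<longleftrightarrow>
     prob_measure_on {0..} M \<and> prob_measure_on {0..} N \<and> prob_measure_on {0..} L \<and>
     (if M = dirac_zero \<or> N = dirac_zero then L = dirac_zero
      else L \<noteq> dirac_zero \<and>
        (\<forall>z \<in> S_domain M \<inter> S_domain N \<inter> S_domain L.
           S_transform L z = S_transform M z * S_transform N z))"

text \<open>\<open>P n\<close> is the power $M^{\boxtimes n}$ for all \<open>n \<ge> 1\<close>; \<open>P 0\<close> is irrelevant.\<close>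

definition free_mult_powers :: "real measure \<Rightarrow> (nat \<Rightarrow> real measure) \<Rightarrow> bool" where
  "free_mult_powers M P \<longleftrightarrow> P 1 = M \<and> (\<forall>n\<ge>1. is_free_mult_conv (P n) M (P (Suc n)))"

text \<open>
  \<open>is_Phi M L\<close> says that $L = \Phi(M)$, the weak limit of $(M^{\boxtimes n})^{1/n}$.  Weak limits
  being unique, there is at most one such \<open>L\<close>; that there is one is the theorem of Tucci and of
  Haagerup and Moeller.
\<close>

definition is_Phi :: "real measure \<Rightarrow> real measure \<Rightarrow> bool" where
  "is_Phi M L \<longleftrightarrow>
     prob_measure_on {0..} M \<and> prob_measure_on {0..} L \<and>
     (\<exists>P. free_mult_powers M P \<and>
          weak_conv_m (\<lambda>n. pushforward_powr (P n) (1 / real n)) L)"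

end

theory Submission
  imports Defs
begin

text \<open>
  By definition $R_1(\Lambda_d)$ is the arithmetic and, in the absence of zeros, $R_d(\Lambda_d)$ the
  harmonic mean of $\Lambda_d$, and the product of all the $R_i(\Lambda_d)$ telescopes to the product
  of $\Lambda_d$.  So the three quantities in question are $\int t\,\mathrm{d}\mu_d$,
  $(\int t^{-1}\,\mathrm{d}\mu_d)^{-1}$ and $\int \ln t\,\mathrm{d}\mu_d$; the integrands are continuous
  on compact intervals supporting the measures, and weak convergence gives the limits, with
  $\int \ln t\,\mathrm{d}\mu$ as the third.

  What remains is the identity $\int \ln t\,\mathrm{d}\Phi(\mu) = \int \ln t\,\mathrm{d}\mu$ for a measure
  $\mu$ on $[a, b]$ with $a > 0$ (\<open>integral_ln_Phi\<close>).  Put $h_M(x) = \int \frac{1}{1 + x t}\,M(\mathrm{d}t)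
  = 1 + \psi_M(-x)$.  The S-transform is characterized by
  $h_M\big(\frac{1-u}{u} S_M(u-1)\big) = u$.  For $M = \mu^{\boxtimes n}$, where $S_M = S_\mu^n$, the
  substitution $t = s^n$ turns this into
  \[ \int \frac{1}{1 + \frac{1-u}{u} (s / Q(u))^n}\,\nu_n(\mathrm{d}s) = u, \qquad
     Q(u) = \frac{1}{S_\mu(u-1)}, \]
  $\nu_n$ being the image of $\mu^{\boxtimes n}$ under the $n$-th root.  As $n \to \infty$ the kernel tends to the indicator of
  $[0, Q(u))$, so $Q(u)$ is a $u$-quantile of the weak limit $\Phi(\mu)$ (\<open>weak_limit_quantile\<close>).
  Hence $\Phi(\mu)$ is the law of $Q$ under the uniform distribution on $(0, 1)$
  (\<open>Phi_eq_distr_quantile\<close>); as $Q$ takes its values in $[a, b]$, the logarithm is integrable.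

  Finally $\int_0^1 \ln Q(u)\,\mathrm{d}u = \int \ln t\,\mathrm{d}\mu$ (\<open>integral_ln_Phi_quantile\<close>),
  because $-\ln Q$ has the primitive
  \[ H(u) = \int \ln\big(u\,Q(u) + (1-u)\,t\big)\,\mu(\mathrm{d}t) - u \ln Q(u), \]
  with boundary values $H(0) = \int \ln t\,\mathrm{d}\mu$ and $H(1) = 0$.  The derivative of $H$ is found
  by an envelope argument: for fixed $u$ the expression defining $H$ is stationary in $Q(u)$.
\<close>

section \<open>Elementary symmetric functions and the ratios\<close>

lemma esym_1: "esym d x 1 = (\<Sum>i=1..d. x i)"
proof -
  have "{J. J \<subseteq> {1..d} \<and> card J = 1} = (\<lambda>i. {i}) ` {1..d}"
    by (auto simp: card_1_singleton_iff)
  then show ?thesis unfolding esym_def by (simp add: sum.reindex)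
qed

lemma esym_0: "esym d x 0 = 1"
proof -
  have "{J. J \<subseteq> {1..d} \<and> card J = 0} = {{}}" by (auto dest: finite_subset)
  then show ?thesis unfolding esym_def by simp
qed

lemma esym_top: "esym d x d = (\<Prod>i=1..d. x i)"
proof -
  have "{J. J \<subseteq> {1..d} \<and> card J = d} = {{1..d}}"
    by (auto dest: card_subset_eq[rotated])
  then show ?thesis unfolding esym_def by simp
qed

lemma esym_below_top:
  fixes x :: "nat \<Rightarrow> real"
  assumes d: "1 \<le> d" and nz: "\<And>i. i \<in> {1..d} \<Longrightarrow> x i \<noteq> 0"
  shows "esym d x (d - 1) = (\<Prod>i=1..d. x i) * (\<Sum>i=1..d. inverse (x i))"
proof -
  have "{J. J \<subseteq> {1..d} \<and> card J = d - 1} = (\<lambda>i. {1..d} - {i}) ` {1..d}"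
  proof (intro equalityI subsetI)
    fix J assume J: "J \<in> {J. J \<subseteq> {1..d} \<and> card J = d - 1}"
    then have "card ({1..d} - J) = 1" using d by (subst card_Diff_subset) (auto intro: finite_subset)
    then obtain i where "{1..d} - J = {i}" by (auto simp: card_1_singleton_iff)
    then show "J \<in> (\<lambda>i. {1..d} - {i}) ` {1..d}" using J by (intro image_eqI[of _ _ i]) auto
  qed (auto simp: card_Diff_subset)
  moreover have "inj_on (\<lambda>i. {1..d} - {i}) {1..d}" by (auto simp: inj_on_def)
  moreover have "(\<Prod>j\<in>{1..d} - {i}. x j) = (\<Prod>i=1..d. x i) * inverse (x i)" if "i \<in> {1..d}" for i
    using that nz[OF that] by (subst prod.remove[of "{1..d}" i]) (auto simp: field_simps)
  ultimately show ?thesis unfolding esym_def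
    by (simp add: sum.reindex sum_distrib_left)
qed

lemma esym_normalized_pos:
  fixes x :: "nat \<Rightarrow> real"
  assumes "\<And>i. i \<in> {1..d} \<Longrightarrow> 0 < x i" "k \<le> d"
  shows "0 < esym_normalized d x k"
proof -
  have "0 < esym d x k" unfolding esym_def
  proof (rule sum_pos)
    show "finite {J. J \<subseteq> {1..d} \<and> card J = k}" by (auto intro: finite_subset[of _ "Pow {1..d}"])
    show "{J. J \<subseteq> {1..d} \<and> card J = k} \<noteq> {}"
      using assms(2) by (auto intro!: exI[of _ "{1..k}"])
  qed (use assms in \<open>auto intro!: prod_pos\<close>)
  then show ?thesis using assms(2) by (simp add: esym_normalized_def)
qed

lemma zero_count_eq_0:
  fixes x :: "nat \<Rightarrow> real"
  assumes "\<And>i. i \<in> {1..d} \<Longrightarrow> 0 < x i" shows "zero_count d x = 0"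
  using assms by (force simp: zero_count_def)

text \<open>
If all entries vanish, the ratio is 0 by definition, and so is the mean.
\<close>
lemma R_ratio_1:
  fixes x :: "nat \<Rightarrow> real"
  assumes "1 \<le> d" shows "R_ratio d x 1 = (\<Sum>i=1..d. x i) / real d"
proof (cases "1 \<le> d - zero_count d x")
  case True
  then show ?thesis
    using esym_1[of d x] esym_0[of d x] by (simp add: R_ratio_def esym_normalized_def)
next
  case False
  have "{j \<in> {1..d}. x j = 0} = {1..d}"
    using False by (intro card_subset_eq) (auto simp: zero_count_def intro!: antisym card_mono[of "{1..d}", simplified])
  then show ?thesis using False by (auto simp: R_ratio_def intro!: sum.neutral)
qed

lemma R_ratio_top:
  fixes x :: "nat \<Rightarrow> real"
  assumes d: "1 \<le> d" and pos: "\<And>i. i \<in> {1..d} \<Longrightarrow> 0 < x i"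
  shows "R_ratio d x d = inverse ((\<Sum>i=1..d. inverse (x i)) / real d)"
proof -
  have "(\<Prod>i=1..d. x i) \<noteq> 0" using pos by (force simp: prod_zero_iff)
  moreover have "d choose (d - 1) = d" using d by (metis binomial_symmetric choose_one diff_le_self
        diff_diff_cancel)
  moreover have nz: "\<And>i. i \<in> {1..d} \<Longrightarrow> x i \<noteq> 0" using pos by fastforce
  ultimately show ?thesis using d zero_count_eq_0[OF pos] esym_below_top[OF d nz] esym_top[of d x]
    by (simp add: R_ratio_def esym_normalized_def field_simps)
qed

text \<open>
The product of the ratios telescopes to $\widetilde e_d / \widetilde e_0$, which is the product of
the entries.
\<close>
lemma sum_ln_R_ratio:
  fixes x :: "nat \<Rightarrow> real"
  assumes pos: "\<And>i. i \<in> {1..d} \<Longrightarrow> 0 < x i"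
  shows "(\<Sum>i=1..d. ln (R_ratio d x i)) = (\<Sum>i=1..d. ln (x i))"
proof -
  let ?e = "esym_normalized d x"
  have ne: "0 < ?e k" if "k \<le> d" for k using esym_normalized_pos[OF pos that] .
  have "(\<Sum>i=1..d. ln (R_ratio d x i)) = (\<Sum>i=1..d. ln (?e i) - ln (?e (i - 1)))"
  proof (intro sum.cong refl)
    fix i assume "i \<in> {1..d}"
    then have "0 < ?e i" "0 < ?e (i - 1)" "i \<le> d - zero_count d x"
      using ne zero_count_eq_0[of d x] pos by auto
    then show "ln (R_ratio d x i) = ln (?e i) - ln (?e (i - 1))"
      by (simp add: R_ratio_def ln_div)
  qed
  also have "\<dots> = ln (?e d) - ln (?e 0)"
    using sum_telescope''[of 0 d "\<lambda>k. ln (?e k)"] by (simp add: atLeastSucAtMost_greaterThanAtMost)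
  also have "\<dots> = ln (\<Prod>i=1..d. x i)"
    by (simp add: esym_normalized_def esym_0 esym_top)
  also have "\<dots> = (\<Sum>i=1..d. ln (x i))"
  proof (rule ln_prod)
    show "x i \<noteq> 0" if "i \<in> {1..d}" for i using pos[OF that] by simp
  qed simp
  finally show ?thesis .
qed

section \<open>Weak convergence on compact intervals\<close>

lemma prob_measure_on_AE:
  assumes "prob_measure_on K M" shows "AE t in M. t \<in> K"
proof -
  interpret real_distribution M using assms by (simp add: prob_measure_on_def)
  show ?thesis using assms by (intro AE_prob_1) (simp add: prob_measure_on_def)
qed

lemma real_distribution_empirical_measure: "real_distribution (empirical_measure d x)"
proof -
  have "prob_space (distr (measure_pmf (pmf_of_set {1..d})) borel x)"
    by (rule measure_pmf.prob_space_distr) simp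
  then show ?thesis unfolding empirical_measure_def
    by (simp add: real_distribution_def real_distribution_axioms_def)
qed

lemma integral_empirical_measure:
  fixes f :: "real \<Rightarrow> real"
  assumes "f \<in> borel_measurable borel" "1 \<le> d"
  shows "(LINT t|empirical_measure d x. f t) = (\<Sum>i=1..d. f (x i)) / real d"
proof -
  have "(LINT t|empirical_measure d x. f t) = (LINT i|measure_pmf (pmf_of_set {1..d}). f (x i))"
    unfolding empirical_measure_def using assms by (intro integral_distr) auto
  also have "\<dots> = (\<Sum>i=1..d. f (x i)) / real d"
    using assms(2) by (subst integral_pmf_of_set) auto
  finally show ?thesis .
qed

lemma empirical_measure_support:
  assumes "prob_measure_on K (empirical_measure d x)" "1 \<le> d" "i \<in> {1..d}" "K \<in> sets borel"
  shows "x i \<in> K"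
proof -
  have "AE t in empirical_measure d x. t \<in> K" using assms(1) by (rule prob_measure_on_AE)
  then have "AE i in measure_pmf (pmf_of_set {1..d}). x i \<in> K"
    unfolding empirical_measure_def using assms(4) by (subst (asm) AE_distr_iff) auto
  then show ?thesis using assms(2,3) by (auto simp: AE_measure_pmf_iff)
qed

text \<open>
A function continuous on $[a, b]$ need not be bounded or continuous elsewhere ($\ln$ and the inverse
are not at 0), so it is first composed with the retraction of the line onto $[a, b]$.
\<close>
lemma weak_conv_integral_compact:
  fixes f :: "real \<Rightarrow> real"
  assumes Mn: "\<And>n. real_distribution (Mn n)" and M: "real_distribution M"
    and conv: "weak_conv_m Mn M"
    and supp: "\<And>n. n \<ge> 1 \<Longrightarrow> AE t in Mn n. t \<in> {a..b}" "AE t in M. t \<in> {a..b}"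
    and f: "continuous_on {a..b} f" "f \<in> borel_measurable borel" and ab: "a \<le> b"
  shows "(\<lambda>n. LINT t|Mn n. f t) \<longlonglongrightarrow> (LINT t|M. f t)"
proof -
  define g where "g t = f (max a (min b t))" for t
  have "continuous_on UNIV g" unfolding g_def
    by (intro continuous_on_compose2[OF f(1)] continuous_intros) (use ab in auto)
  then have g: "isCont g t" for t by (simp add: continuous_on_eq_continuous_at)
  obtain B where B: "\<And>t. t \<in> {a..b} \<Longrightarrow> norm (f t) \<le> B"
    using compact_imp_bounded[OF compact_continuous_image[OF f(1) compact_Icc]]
    unfolding bounded_iff by blast
  have "(\<lambda>n. LINT t|Mn n. g t) \<longlonglongrightarrow> (LINT t|M. g t)"
  proof (rule weak_conv_imp_integral_bdd_continuous_conv[OF Mn M conv g])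
    show "norm (g t) \<le> B" for t unfolding g_def using ab by (intro B) auto
  qed
  moreover have eq: "(LINT t|N. g t) = (LINT t|N. f t)"
    if "real_distribution N" "AE t in N. t \<in> {a..b}" for N
  proof -
    interpret real_distribution N by fact
    have [measurable]: "g \<in> borel_measurable borel" "f \<in> borel_measurable borel"
      using g f(2) by (auto intro: borel_measurable_continuous_onI simp: continuous_at_imp_continuous_on)
    show ?thesis
    proof (intro integral_cong_AE)
      show "AE t in N. g t = f t" using that(2) by eventually_elim (simp add: g_def)
    qed simp_all
  qed
  have "eventually (\<lambda>n. (LINT t|Mn n. g t) = (LINT t|Mn n. f t)) sequentially"
    using eventually_ge_at_top[of 1] by eventually_elim (intro eq Mn supp)
  ultimately show ?thesis using eq[OF M supp(2)] by (simp add: tendsto_cong)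
qed

section \<open>The moment transform on the negative half-line and the S-transform\<close>

text \<open>
This is $1 + \psi_M(-x)$.  For $M$ on $[0, \infty)$ it decreases from 1 at $x \to 0$ to $M(\{0\})$ at
$x \to \infty$, and working with it instead of $\psi_M$ keeps every integrand in $[0, 1]$.
\<close>
definition smoothed_atom :: "real measure \<Rightarrow> real \<Rightarrow> real" where
  "smoothed_atom M x = (LINT t|M. 1 / (1 + x * t))"

lemma kernel_bounds:
  fixes t x :: real
  assumes "0 \<le> t" "0 < x" shows "0 < 1 / (1 + x * t)" "1 / (1 + x * t) \<le> 1" "1 + x * t > 0"
  using assms by (auto simp: field_simps add_pos_nonneg)

locale nonneg_law = real_distribution M for M :: "real measure" +
  assumes AE_nonneg: "AE t in M. 0 \<le> t"

lemma prob_measure_on_nonneg_law: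
  assumes "prob_measure_on {0..} M" shows "nonneg_law M"
proof -
  interpret real_distribution M using assms by (simp add: prob_measure_on_def)
  have "AE t in M. t \<in> {0..}" using assms by (rule prob_measure_on_AE)
  then show ?thesis by unfold_locales auto
qed

context nonneg_law
begin

lemma integrable_kernel:
  assumes "0 < x" shows "integrable M (\<lambda>t. 1 / (1 + x * t))"
proof (rule integrable_const_bound[where B = 1])
  show "AE t in M. norm (1 / (1 + x * t)) \<le> 1"
    using AE_nonneg by eventually_elim (use assms kernel_bounds in \<open>auto simp: abs_of_pos\<close>)
qed simp

lemma smoothed_atom_bounds:
  assumes "0 < x" shows "measure M {0} \<le> smoothed_atom M x" "smoothed_atom M x \<le> 1"
proof -
  have "measure M {0} = (LINT t|M. indicator {0} t)" by simp
  also have "\<dots> \<le> smoothed_atom M x" unfolding smoothed_atom_def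
  proof (intro integral_mono_AE integrable_kernel assms)
    show "AE t in M. indicator {0} t \<le> 1 / (1 + x * t)"
      using AE_nonneg by eventually_elim (use assms kernel_bounds(1)[OF _ assms] in \<open>auto simp: indicator_def less_imp_le\<close>)
  qed (auto simp: emeasure_eq_measure)
  finally show "measure M {0} \<le> smoothed_atom M x" .
  have "smoothed_atom M x \<le> (LINT t|M. 1)" unfolding smoothed_atom_def
  proof (intro integral_mono_AE integrable_kernel assms)
    show "AE t in M. 1 / (1 + x * t) \<le> 1"
      using AE_nonneg by eventually_elim (use assms kernel_bounds in auto)
  qed auto
  then show "smoothed_atom M x \<le> 1" using prob_space by simp
qed

lemma smoothed_atom_strict_antimono:
  assumes "measure M {0} \<noteq> 1" "0 < x" "x < y"
  shows "smoothed_atom M y < smoothed_atom M x"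
proof -
  let ?g = "\<lambda>t. 1 / (1 + x * t) - 1 / (1 + y * t)"
  have y: "0 < y" using assms by simp
  note int = integrable_kernel[OF \<open>0 < x\<close>] integrable_kernel[OF y]
  have eq: "integral\<^sup>L M ?g = smoothed_atom M x - smoothed_atom M y"
    unfolding smoothed_atom_def by (intro Bochner_Integration.integral_diff int)
  have g: "?g t = (y - x) * t / ((1 + x * t) * (1 + y * t))" if "0 \<le> t" for t
    using kernel_bounds(3)[OF that \<open>0 < x\<close>] kernel_bounds(3)[OF that y]
    by (simp add: field_simps)
  have pos: "AE t in M. 0 \<le> ?g t" using AE_nonneg
  proof eventually_elim
    fix t :: real assume t: "0 \<le> t"
    show "0 \<le> ?g t" unfolding g[OF t]
      using t assms kernel_bounds(3)[OF t \<open>0 < x\<close>] kernel_bounds(3)[OF t y] by simp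
  qed
  have "integral\<^sup>L M ?g \<noteq> 0"
  proof
    assume "integral\<^sup>L M ?g = 0"
    then have "AE t in M. ?g t = 0"
      using integral_nonneg_eq_0_iff_AE[OF _ pos] int by simp
    then have "AE t in M. t \<in> {0}" using AE_nonneg
    proof eventually_elim
      fix t :: real assume "?g t = 0" and t: "0 \<le> t"
      then show "t \<in> {0}" unfolding g[OF t]
        using assms kernel_bounds(3)[OF t \<open>0 < x\<close>] kernel_bounds(3)[OF t y] by simp
    qed
    then show False using assms(1) AE_in_set_eq_1[of "{0}"] by simp
  qed
  moreover have "integral\<^sup>L M ?g \<ge> 0" by (rule integral_nonneg_AE[OF pos])
  ultimately show ?thesis using eq by simp
qed

lemma smoothed_atom_in_interval:
  assumes "measure M {0} \<noteq> 1" "0 < x"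
  shows "smoothed_atom M x \<in> {measure M {0}<..<1}"
  using smoothed_atom_strict_antimono[OF assms(1), of x "x + 1"]
    smoothed_atom_strict_antimono[OF assms(1), of "x / 2" x]
    smoothed_atom_bounds[of "x + 1"] smoothed_atom_bounds[of "x / 2"] assms by auto

text \<open>
The factor $t / (1 + y t)$ of the difference of the two kernels is at most $1 / y$ uniformly
in $t$, although $t$ itself may fail to be integrable.
\<close>
lemma smoothed_atom_lipschitz:
  assumes "0 < x" "0 < y"
  shows "\<bar>smoothed_atom M x - smoothed_atom M y\<bar> \<le> \<bar>x - y\<bar> / y"
proof -
  let ?g = "\<lambda>t. 1 / (1 + x * t) - 1 / (1 + y * t)"
  note int = integrable_kernel[OF \<open>0 < x\<close>] integrable_kernel[OF \<open>0 < y\<close>]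
  have eq: "smoothed_atom M x - smoothed_atom M y = integral\<^sup>L M ?g"
    unfolding smoothed_atom_def by (intro Bochner_Integration.integral_diff[symmetric] int)
  have "\<bar>integral\<^sup>L M ?g\<bar> \<le> (LINT t|M. \<bar>?g t\<bar>)" using integral_norm_bound[of M ?g] by simp
  also have "\<dots> \<le> (LINT t|M. \<bar>x - y\<bar> / y)"
  proof (intro integral_mono_AE)
    show "AE t in M. \<bar>?g t\<bar> \<le> \<bar>x - y\<bar> / y" using AE_nonneg
    proof eventually_elim
      fix t :: real assume t: "0 \<le> t"
      note p = kernel_bounds(3)[OF t \<open>0 < x\<close>] kernel_bounds(3)[OF t \<open>0 < y\<close>]
      have "?g t = (y - x) * (t / (1 + y * t)) * (1 / (1 + x * t))"
        using p by (simp add: field_simps)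
      then have "\<bar>?g t\<bar> = \<bar>x - y\<bar> * (t / (1 + y * t)) * (1 / (1 + x * t))"
        using p t by (simp add: abs_mult abs_minus_commute)
      also have "\<dots> \<le> \<bar>x - y\<bar> * (1 / y) * 1"
        using p t assms kernel_bounds(2)[OF t \<open>0 < x\<close>]
        by (intro mult_mono) (auto simp: field_simps)
      finally show "\<bar>?g t\<bar> \<le> \<bar>x - y\<bar> / y" by simp
    qed
  qed (use int in auto)
  also have "\<dots> = \<bar>x - y\<bar> / y" using prob_space by simp
  finally show ?thesis using eq by simp
qed

lemma isCont_smoothed_atom:
  assumes "0 < y" shows "isCont (smoothed_atom M) y"
proof -
  have "((\<lambda>x. \<bar>x - y\<bar> / y) \<longlongrightarrow> \<bar>y - y\<bar> / y) (at y)"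
    using assms by (intro tendsto_intros) auto
  then have "((\<lambda>x. \<bar>x - y\<bar> / y) \<longlongrightarrow> 0) (at y)" by simp
  moreover have "eventually (\<lambda>x. norm (smoothed_atom M x - smoothed_atom M y) \<le> \<bar>x - y\<bar> / y) (at y)"
    using eventually_at_in_open'[of "{0<..}" y] assms
    by (auto elim!: eventually_mono intro: smoothed_atom_lipschitz)
  ultimately have "((\<lambda>x. smoothed_atom M x - smoothed_atom M y) \<longlongrightarrow> 0) (at y)"
    by (rule Lim_null_comparison[rotated])
  then show ?thesis by (simp add: isCont_def LIM_zero_cancel)
qed

lemma smoothed_atom_limits:
  shows "(\<lambda>n. smoothed_atom M (1 / real (Suc n))) \<longlonglongrightarrow> 1"
    and "(\<lambda>n. smoothed_atom M (real (Suc n))) \<longlonglongrightarrow> measure M {0}"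
proof -
  have "(\<lambda>n. smoothed_atom M (1 / real (Suc n))) \<longlonglongrightarrow> (LINT t|M. 1)"
    unfolding smoothed_atom_def
  proof (rule integral_dominated_convergence[where w = "\<lambda>_. 1"])
    show "AE t in M. (\<lambda>n. 1 / (1 + 1 / real (Suc n) * t)) \<longlonglongrightarrow> 1"
    proof (rule AE_I2)
      fix t :: real
      have "(\<lambda>n. 1 / (1 + 1 / real (Suc n) * t)) \<longlonglongrightarrow> 1 / (1 + 0 * t)"
        using LIMSEQ_inverse_real_of_nat
        by (intro tendsto_intros) (auto simp: inverse_eq_divide)
      then show "(\<lambda>n. 1 / (1 + 1 / real (Suc n) * t)) \<longlonglongrightarrow> 1" by simp
    qed
    fix n
    show "AE t in M. norm (1 / (1 + 1 / real (Suc n) * t)) \<le> 1" using AE_nonneg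
    proof eventually_elim
      fix t :: real assume "0 \<le> t"
      then show "norm (1 / (1 + 1 / real (Suc n) * t)) \<le> 1"
        using kernel_bounds[of t "1 / real (Suc n)"] by (simp add: abs_of_pos)
    qed
  qed auto
  then show "(\<lambda>n. smoothed_atom M (1 / real (Suc n))) \<longlonglongrightarrow> 1" using prob_space by simp
  have "(\<lambda>n. smoothed_atom M (real (Suc n))) \<longlonglongrightarrow> (LINT t|M. indicator {0} t)"
    unfolding smoothed_atom_def
  proof (rule integral_dominated_convergence[where w = "\<lambda>_. 1"])
    show "AE t in M. (\<lambda>n. 1 / (1 + real (Suc n) * t)) \<longlonglongrightarrow> indicator {0} t" using AE_nonneg
    proof eventually_elim
      fix t :: real assume t: "0 \<le> t"
      show "(\<lambda>n. 1 / (1 + real (Suc n) * t)) \<longlonglongrightarrow> indicator {0} t"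
      proof (cases "t = 0")
        case False
        have "(\<lambda>n. 1 / (1 + real n * t)) \<longlonglongrightarrow> 0" using t False
          by (intro real_tendsto_divide_at_top[OF tendsto_const]
              filterlim_tendsto_add_at_top[OF tendsto_const]
              filterlim_at_top_mult_tendsto_pos[OF tendsto_const _ filterlim_real_sequentially]) auto
        then show ?thesis using LIMSEQ_Suc False by fastforce
      qed simp
    qed
    fix n
    show "AE t in M. norm (1 / (1 + real (Suc n) * t)) \<le> 1" using AE_nonneg
    proof eventually_elim
      fix t :: real assume "0 \<le> t"
      then show "norm (1 / (1 + real (Suc n) * t)) \<le> 1"
        using kernel_bounds[of t "real (Suc n)"] by (simp add: abs_of_pos)
    qed
  qed auto
  then show "(\<lambda>n. smoothed_atom M (real (Suc n))) \<longlonglongrightarrow> measure M {0}" by simp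
qed

lemma smoothed_atom_surj:
  assumes "u \<in> {measure M {0}<..<1}"
  obtains x where "0 < x" "smoothed_atom M x = u"
proof -
  have "eventually (\<lambda>n. u < smoothed_atom M (1 / real (Suc n))) sequentially"
    using assms by (intro order_tendstoD(1)[OF smoothed_atom_limits(1)]) auto
  moreover have "eventually (\<lambda>n. smoothed_atom M (real (Suc n)) < u) sequentially"
    using assms by (intro order_tendstoD(2)[OF smoothed_atom_limits(2)]) auto
  ultimately obtain n where n: "u < smoothed_atom M (1 / real (Suc n))"
      "smoothed_atom M (real (Suc n)) < u"
    using eventually_happens[OF eventually_conj] by fastforce
  have "1 / real (Suc n) \<le> 1 / 1" by (intro divide_left_mono) auto
  also have "\<dots> \<le> real (Suc n)" by simp
  finally have le: "1 / real (Suc n) \<le> real (Suc n)" .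
  have pos: "0 < x" if "1 / real (Suc n) \<le> x" for x
    by (rule less_le_trans[OF _ that]) simp
  have "\<exists>x. 1 / real (Suc n) \<le> x \<and> x \<le> real (Suc n) \<and> smoothed_atom M x = u"
  proof (rule IVT2)
    show "\<forall>x. 1 / real (Suc n) \<le> x \<and> x \<le> real (Suc n) \<longrightarrow> isCont (smoothed_atom M) x"
      using pos isCont_smoothed_atom by blast
  qed (use n le in \<open>simp_all only: less_imp_le\<close>)
  then obtain x where "1 / real (Suc n) \<le> x" "smoothed_atom M x = u" by blast
  then show ?thesis using that[of x] pos by blast
qed

lemma psi_transform_eq_smoothed_atom:
  assumes "0 < x" shows "psi_transform M (- x) = smoothed_atom M x - 1"
proof -
  have "psi_transform M (- x) = (LINT t|M. 1 / (1 + x * t) - 1)" unfolding psi_transform_def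
  proof (intro integral_cong_AE)
    show "AE t in M. of_real t * - x / (1 - of_real t * - x) = 1 / (1 + x * t) - 1" using AE_nonneg
    proof eventually_elim
      fix t :: real assume t: "0 \<le> t"
      show "of_real t * - x / (1 - of_real t * - x) = 1 / (1 + x * t) - 1"
        using kernel_bounds(3)[OF t assms] by (simp add: field_simps)
    qed
  qed auto
  also have "\<dots> = smoothed_atom M x - 1" unfolding smoothed_atom_def
    using integrable_kernel[OF assms] prob_space by simp
  finally show ?thesis .
qed

text \<open>
The defining equation of the S-transform in terms of \<open>smoothed_atom\<close>: with $u = z + 1$, the
preimage of $z$ under $\psi_M$ is $-x$, and $\frac{z+1}{z} \cdot (-x) = \frac{x u}{1-u}$.
\<close>
lemma S_transform_eq:
  assumes "measure M {0} \<noteq> 1" "0 < x" "smoothed_atom M x = u"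
  shows "S_transform M (u - 1) = x * u / (1 - u)"
proof -
  have "inj_on (psi_transform M) {..<0::real}"
  proof (rule linorder_inj_onI')
    fix i j :: real assume "i \<in> {..<0}" "j \<in> {..<0}" "i < j"
    then show "psi_transform M i \<noteq> psi_transform M j"
      using psi_transform_eq_smoothed_atom[of "- i"] psi_transform_eq_smoothed_atom[of "- j"]
        smoothed_atom_strict_antimono[OF assms(1), of "- j" "- i"] by auto
  qed
  moreover have "psi_transform M (- x) = u - 1"
    using psi_transform_eq_smoothed_atom assms by simp
  ultimately have "the_inv_into {..<0} (psi_transform M) (u - 1) = - x"
    using assms(2) by (intro the_inv_into_f_eq) auto
  moreover have "u < 1" using smoothed_atom_in_interval[OF assms(1,2)] assms(3) by simp
  ultimately show ?thesis unfolding S_transform_def by (simp add: field_simps)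
qed

lemma smoothed_atom_S_transform:
  assumes "measure M {0} \<noteq> 1" "u \<in> {measure M {0}<..<1}"
  shows "0 < S_transform M (u - 1)" "smoothed_atom M ((1 - u) / u * S_transform M (u - 1)) = u"
proof -
  obtain x where x: "0 < x" "smoothed_atom M x = u" using smoothed_atom_surj[OF assms(2)] .
  have "0 \<le> measure M {0}" by simp
  then have "0 < u" "u < 1" using assms(2) by (auto simp del: measure_nonneg)
  then show "0 < S_transform M (u - 1)" "smoothed_atom M ((1 - u) / u * S_transform M (u - 1)) = u"
    unfolding S_transform_eq[OF assms(1) x] using x by auto
qed

lemma eq_dirac_zero:
  assumes "measure M {0} = 1" shows "M = dirac_zero"
proof (rule cdf_unique)
  show "real_distribution M" ..
  show "real_distribution dirac_zero"
    by (auto simp: real_distribution_def real_distribution_axioms_def prob_space_return)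
  have "AE t in M. t \<in> {0}" using assms by (rule AE_prob_1)
  then have "measure M A = indicator A 0" if "A \<in> sets borel" for A
  proof -
    have "measure M A = (LINT t|M. indicator A t)" using that by simp
    also have "\<dots> = (LINT t|M. indicator A 0)"
      by (intro integral_cong_AE) (use that \<open>AE t in M. t \<in> {0}\<close> in auto)
    finally show ?thesis using prob_space by simp
  qed
  then show "cdf M = cdf dirac_zero"
    by (auto simp: cdf_def fun_eq_iff measure_return)
qed

end

text \<open>
The equation for $S_L$ is given only on $(L(\{0\}) - 1, 0)$, so the absence of an atom of $L$ at 0
has to be derived.  If $L(\{0\}) = w > 0$, then every \<open>x > 0\<close> is attained at some
$u \in (w, 1)$, and $S_L(u - 1) = x u / (1 - u) \ge x w$; this is unbounded, while
$S_M S_N$ is not.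
\<close>
lemma free_mult_conv_bounded_S:
  assumes conv: "is_free_mult_conv M N L"
    and M: "measure M {0} = 0" and N: "measure N {0} = 0"
    and bound: "\<And>u. u \<in> {0<..<1} \<Longrightarrow> S_transform M (u - 1) * S_transform N (u - 1) \<le> C"
  shows "measure L {0} = 0"
    and "u \<in> {0<..<1} \<Longrightarrow> S_transform L (u - 1) = S_transform M (u - 1) * S_transform N (u - 1)"
proof -
  have ne: "M \<noteq> dirac_zero" "N \<noteq> dirac_zero"
    using M N by (auto simp: measure_return)
  have L: "prob_measure_on {0..} L" "L \<noteq> dirac_zero"
    and S: "\<And>z. z \<in> S_domain M \<inter> S_domain N \<inter> S_domain L \<Longrightarrow>
           S_transform L z = S_transform M z * S_transform N z"
    using conv ne unfolding is_free_mult_conv_def by auto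
  interpret L: nonneg_law L using L(1) by (rule prob_measure_on_nonneg_law)
  have L1: "measure L {0} \<noteq> 1" using L.eq_dirac_zero L(2) by blast
  let ?w = "measure L {0}"
  have S': "S_transform L (u - 1) = S_transform M (u - 1) * S_transform N (u - 1)"
    if "u \<in> {?w<..<1}" for u
  proof -
    have "0 \<le> ?w" by simp
    then show ?thesis using that M N by (intro S) (auto simp: S_domain_def simp del: measure_nonneg)
  qed
  show w0: "?w = 0"
  proof (rule ccontr)
    assume "?w \<noteq> 0"
    then have w: "?w > 0" by (simp add: zero_less_measure_iff)
    \<comment> \<open>chosen so that already the lower bound \<open>x * ?w\<close> for the S-transform of \<open>L\<close> exceeds \<open>C\<close>\<close>
    define x where "x = max C 0 / ?w + 1"
    define u where "u = smoothed_atom L x"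
    have x: "0 < x" using w by (simp add: x_def add_nonneg_pos)
    have u: "u \<in> {?w<..<1}" unfolding u_def by (rule L.smoothed_atom_in_interval[OF L1 x])
    have "x * u / (1 - u) \<le> C"
      using L.S_transform_eq[OF L1 x u_def[symmetric]] S'[OF u] bound[of u] u w by auto
    moreover have "x * u \<le> x * u / (1 - u)"
      using u w x by (simp add: field_simps mult_nonneg_nonneg)
    moreover have "x * ?w \<le> x * u" using x u by simp
    moreover have "x * ?w = max C 0 + ?w" using w by (simp add: x_def field_simps)
    ultimately show False using w by simp
  qed
  show "u \<in> {0<..<1} \<Longrightarrow> S_transform L (u - 1) = S_transform M (u - 1) * S_transform N (u - 1)"
    using S'[of u] w0 by simp
qed

section \<open>The logarithmic integral of the S-transform\<close>

text \<open>
Exchanging the roles of the two points in the supergradient inequality traps the difference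
quotient of \<open>f\<close> between values of \<open>g\<close>, so continuity of \<open>g\<close> alone makes \<open>f\<close> differentiable.
\<close>
lemma has_real_derivative_of_supergradient:
  fixes f g :: "real \<Rightarrow> real"
  assumes "open S" "u \<in> S" "isCont g u"
    and super: "\<And>v w. v \<in> S \<Longrightarrow> w \<in> S \<Longrightarrow> f v \<le> f w + (v - w) * g w"
  shows "(f has_real_derivative g u) (at u)"
proof -
  have bound: "norm ((f v - f u) / (v - u) - g u) \<le> \<bar>g v - g u\<bar>" if v: "v \<in> S" "v \<noteq> u" for v
  proof -
    have "\<bar>(f v - f u) - (v - u) * g u\<bar> \<le> \<bar>(v - u) * (g v - g u)\<bar>"
      using super[OF v(1) assms(2)] super[OF assms(2) v(1)] by (simp add: algebra_simps)
    then have "\<bar>(f v - f u) - (v - u) * g u\<bar> / \<bar>v - u\<bar> \<le> \<bar>g v - g u\<bar>"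
      using v(2) by (simp add: abs_mult pos_divide_le_eq mult.commute)
    moreover have "(f v - f u) / (v - u) - g u = ((f v - f u) - (v - u) * g u) / (v - u)"
      using v(2) by (simp add: field_simps)
    ultimately show ?thesis by simp
  qed
  have "((\<lambda>v. \<bar>g v - g u\<bar>) \<longlongrightarrow> \<bar>g u - g u\<bar>) (at u)"
    using assms(3) unfolding isCont_def by (intro tendsto_intros)
  then have "((\<lambda>v. \<bar>g v - g u\<bar>) \<longlongrightarrow> 0) (at u)" by simp
  moreover have "eventually (\<lambda>v. norm ((f v - f u) / (v - u) - g u) \<le> \<bar>g v - g u\<bar>) (at u)"
    using bound assms(1,2) by (auto simp: eventually_at_topological)
  ultimately have "((\<lambda>v. (f v - f u) / (v - u) - g u) \<longlongrightarrow> 0) (at u)"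
    by (rule Lim_null_comparison[rotated])
  then show ?thesis unfolding has_field_derivative_iff by (rule LIM_zero_cancel)
qed

text \<open>
As a function of $\ln x$, $\ln(1 + x t)$ is convex, with slope $1 - 1/(1 + x t)$: this is its
tangent line inequality.  It reduces to the concavity of $\ln$, because $(1 + y t)/(1 + x t)$ is
the mean of $1$ and $y/x$ with weights $1/(1 + x t)$ and $1 - 1/(1 + x t)$.
\<close>
lemma ln_weighted_bound:
  fixes x y t :: real
  assumes "0 < x" "0 < y" "0 \<le> t"
  shows "ln (1 + x * t) + (ln y - ln x) * (1 - 1 / (1 + x * t)) \<le> ln (1 + y * t)"
proof -
  define w where "w = 1 - 1 / (1 + x * t)"
  have p: "0 < 1 + x * t" "0 < 1 + y * t" using assms by (auto intro: add_pos_nonneg)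
  have w: "0 \<le> w" "w \<le> 1" using p assms by (auto simp: w_def)
  have "(1 - w) * ln 1 + w * ln (y / x) \<le> ln ((1 - w) *\<^sub>R 1 + w *\<^sub>R (y / x))"
    using assms w by (intro concave_onD[OF ln_concave]) auto
  also have "(1 - w) *\<^sub>R 1 + w *\<^sub>R (y / x) = (1 + y * t) / (1 + x * t)"
    unfolding w_def using p assms by (simp add: field_simps)
  finally show ?thesis using assms p by (simp add: ln_div w_def algebra_simps)
qed

lemma abs_ln_diff_le:
  fixes a y z :: real
  assumes "0 < a" "a \<le> y" "a \<le> z" shows "\<bar>ln y - ln z\<bar> \<le> \<bar>y - z\<bar> / a"
proof -
  have "ln y - ln z \<le> (y - z) / z" "ln z - ln y \<le> (z - y) / y"
    using assms by (auto intro: ln_diff_le)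
  moreover have "(y - z) / z \<le> \<bar>y - z\<bar> / a" "(z - y) / y \<le> \<bar>y - z\<bar> / a"
    using assms by (auto intro!: frac_le)
  ultimately show ?thesis by linarith
qed

lemma abs_ln_le:
  fixes a b y :: real
  assumes "0 < a" "a \<le> y" "y \<le> b" shows "\<bar>ln y\<bar> \<le> \<bar>ln a\<bar> + \<bar>ln b\<bar>"
proof -
  have "ln a \<le> ln y" "ln y \<le> ln b" using assms by auto
  then show ?thesis by linarith
qed

text \<open>
The name is justified by \<open>Phi_eq_distr_quantile\<close> below: this is the quantile function of
$\Phi(M)$.
\<close>
definition Phi_quantile :: "real measure \<Rightarrow> real \<Rightarrow> real" where
  "Phi_quantile M u = 1 / S_transform M (u - 1)"

locale bounded_law = real_distribution M for M :: "real measure" +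
  fixes a b :: real
  assumes a_pos: "0 < a" and AE_bounded: "AE t in M. a \<le> t \<and> t \<le> b"

sublocale bounded_law \<subseteq> nonneg_law
  by unfold_locales (use AE_bounded a_pos in \<open>auto elim: eventually_mono\<close>)

context bounded_law
begin

lemma no_atom: "measure M {0} = 0"
proof -
  have "AE t in M. t \<notin> {0}" using AE_bounded a_pos by (auto elim: eventually_mono)
  then show ?thesis using prob_eq_0[of "{0}"] by simp
qed

lemma a_le_b: "a \<le> b"
proof -
  have False if "b < a"
  proof -
    have "AE t in M. t \<in> {}" using AE_bounded by eventually_elim (use that in auto)
    then show False using AE_in_set_eq_1[of "{}"] by simp
  qed
  then show ?thesis by force
qed

lemma integrable_bounded:
  assumes [measurable]: "f \<in> borel_measurable borel"
    and "\<And>t. a \<le> t \<Longrightarrow> t \<le> b \<Longrightarrow> \<bar>f t\<bar> \<le> (B::real)"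
  shows "integrable M f"
proof (rule integrable_const_bound[where B = B])
  show "AE t in M. norm (f t) \<le> B" using AE_bounded by eventually_elim (use assms in auto)
qed simp

lemma integral_diff_bound:
  assumes "integrable M f" "integrable M g"
    and "\<And>t. a \<le> t \<Longrightarrow> t \<le> b \<Longrightarrow> \<bar>f t - g t\<bar> \<le> (B::real)"
  shows "\<bar>(LINT t|M. f t) - (LINT t|M. g t)\<bar> \<le> B"
proof -
  have "\<bar>(LINT t|M. f t) - (LINT t|M. g t)\<bar> = \<bar>LINT t|M. f t - g t\<bar>" using assms by simp
  also have "\<dots> \<le> (LINT t|M. \<bar>f t - g t\<bar>)" using integral_norm_bound[of M "\<lambda>t. f t - g t"] by simp
  also have "\<dots> \<le> (LINT t|M. B)"
  proof (intro integral_mono_AE)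
    show "AE t in M. \<bar>f t - g t\<bar> \<le> B" using AE_bounded by eventually_elim (use assms in auto)
  qed (use assms in auto)
  also have "\<dots> = B" using prob_space by simp
  finally show ?thesis .
qed

lemma integrable_ln: "integrable M ln"
  using abs_ln_le[OF a_pos] by (intro integrable_bounded) auto

lemma Phi_quantile_root:
  assumes "u \<in> {0<..<1}"
  shows "0 < Phi_quantile M u" "smoothed_atom M ((1 - u) / (u * Phi_quantile M u)) = u"
  using smoothed_atom_S_transform[of u] assms no_atom by (simp_all add: Phi_quantile_def)

text \<open>
Since $M$ lives on $[a, b]$, \<open>smoothed_atom M x\<close> lies between its values $1/(1 + x b)$ and
$1/(1 + x a)$ for Dirac measures at \<open>b\<close> and \<open>a\<close>; solving for the quantile gives the bounds.
\<close>
lemma Phi_quantile_bounds: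
  assumes u: "u \<in> {0<..<1}"
  shows "Phi_quantile M u \<in> {a..b}"
proof -
  define x where "x = (1 - u) / (u * Phi_quantile M u)"
  have q: "0 < Phi_quantile M u" by (rule Phi_quantile_root(1)[OF u])
  have x: "0 < x" "smoothed_atom M x = u"
    using u q Phi_quantile_root(2)[OF u] by (auto simp: x_def)
  have c: "(LINT t|M. c) = (c::real)" for c using prob_space by simp
  have "(LINT t|M. 1 / (1 + x * b)) \<le> smoothed_atom M x" unfolding smoothed_atom_def
  proof (intro integral_mono_AE integrable_kernel x)
    show "AE t in M. 1 / (1 + x * b) \<le> 1 / (1 + x * t)" using AE_bounded
      by eventually_elim (use x a_pos in \<open>auto intro!: divide_left_mono mult_pos_pos add_pos_nonneg\<close>)
  qed simp
  moreover have "smoothed_atom M x \<le> (LINT t|M. 1 / (1 + x * a))" unfolding smoothed_atom_def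
  proof (intro integral_mono_AE integrable_kernel x)
    show "AE t in M. 1 / (1 + x * t) \<le> 1 / (1 + x * a)" using AE_bounded
      by eventually_elim (use x a_pos in \<open>auto intro!: divide_left_mono mult_pos_pos add_pos_nonneg\<close>)
  qed simp
  ultimately have *: "1 / (1 + x * b) \<le> u" "u \<le> 1 / (1 + x * a)" unfolding c x(2) .
  have p: "0 < 1 + x * a" "0 < 1 + x * b" using x a_pos a_le_b by (auto intro: add_pos_nonneg)
  have "1 \<le> u + u * x * b" "u + u * x * a \<le> 1" using * p by (auto simp: field_simps)
  moreover have "u * x = (1 - u) / Phi_quantile M u" using u q by (simp add: x_def field_simps)
  ultimately have "(1 - u) * 1 \<le> (1 - u) * (b / Phi_quantile M u)"
      "(1 - u) * (a / Phi_quantile M u) \<le> (1 - u) * 1"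
    by auto
  then have "1 \<le> b / Phi_quantile M u" "a / Phi_quantile M u \<le> 1"
    using u by (auto simp only: mult_le_cancel_left_pos greaterThanLessThan_iff diff_gt_0_iff_gt)
  then show ?thesis using q by (auto simp: field_simps)
qed

definition smoothed_atom_inv :: "real \<Rightarrow> real" where
  "smoothed_atom_inv u = (1 - u) / (u * Phi_quantile M u)"

lemma smoothed_atom_inv:
  assumes "u \<in> {0<..<1}" shows "0 < smoothed_atom_inv u" "smoothed_atom M (smoothed_atom_inv u) = u"
proof -
  show "0 < smoothed_atom_inv u" unfolding smoothed_atom_inv_def using assms Phi_quantile_root(1)[OF assms]
    by (intro divide_pos_pos mult_pos_pos) auto
  show "smoothed_atom M (smoothed_atom_inv u) = u" unfolding smoothed_atom_inv_def by (rule Phi_quantile_root(2)[OF assms])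
qed

lemma smoothed_atom_inv_smoothed_atom:
  assumes "0 < x" shows "smoothed_atom_inv (smoothed_atom M x) = x"
proof -
  have m: "measure M {0} \<noteq> 1" using no_atom by simp
  have u: "smoothed_atom M x \<in> {0<..<1}" using smoothed_atom_in_interval[OF m assms] no_atom by simp
  have "\<not> smoothed_atom_inv (smoothed_atom M x) < x" "\<not> x < smoothed_atom_inv (smoothed_atom M x)"
    using smoothed_atom_strict_antimono[OF m smoothed_atom_inv(1)[OF u], of x]
      smoothed_atom_strict_antimono[OF m assms, of "smoothed_atom_inv (smoothed_atom M x)"] smoothed_atom_inv(2)[OF u] by auto
  then show ?thesis by simp
qed

lemma isCont_smoothed_atom_inv:
  assumes "u \<in> {0<..<1}" shows "isCont smoothed_atom_inv u"
proof -
  have pos: "0 < z" if "\<bar>z - smoothed_atom_inv u\<bar> \<le> smoothed_atom_inv u / 2" for z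
    using that smoothed_atom_inv(1)[OF assms] by linarith
  have "isCont smoothed_atom_inv (smoothed_atom M (smoothed_atom_inv u))"
    by (rule isCont_inverse_function[where d = "smoothed_atom_inv u / 2"])
       (simp, fact smoothed_atom_inv(1)[OF assms], blast intro: pos smoothed_atom_inv_smoothed_atom, blast intro: pos isCont_smoothed_atom)
  then show ?thesis using smoothed_atom_inv(2)[OF assms] by simp
qed

lemma isCont_Phi_quantile:
  assumes u: "u \<in> {0<..<1}" shows "isCont (Phi_quantile M) u"
proof -
  have "isCont (\<lambda>u. (1 - u) / (u * smoothed_atom_inv u)) u"
    using isCont_smoothed_atom_inv[OF u] smoothed_atom_inv[OF u] u by (intro continuous_intros) auto
  moreover have "eventually (\<lambda>v. v \<in> {0<..<1}) (nhds u)"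
    using u by (intro eventually_nhds_in_open) auto
  then have "eventually (\<lambda>v. Phi_quantile M v = (1 - v) / (v * smoothed_atom_inv v)) (nhds u)"
  proof eventually_elim
    fix v :: real assume "v \<in> {0<..<1}"
    then show "Phi_quantile M v = (1 - v) / (v * smoothed_atom_inv v)"
      using Phi_quantile_root(1)[of v] by (simp add: smoothed_atom_inv_def)
  qed
  ultimately show ?thesis by (simp add: isCont_cong)
qed

lemma ln_smoothed_atom_inv:
  assumes "u \<in> {0<..<1}" shows "ln (smoothed_atom_inv u) = ln (1 - u) - ln u - ln (Phi_quantile M u)"
  using assms Phi_quantile_root(1)[OF assms] by (simp add: smoothed_atom_inv_def ln_div ln_mult)

text \<open>
This is $\inf_x \big( \int \ln(1 + x t)\,M(\mathrm{d}t) - (1-u) \ln x \big)$, evaluated at its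
minimizer: stationarity in $\ln x$ is the equation \<open>smoothed_atom M x = u\<close>.  As an infimum of
functions affine in $u$ it is concave, and the slope $\ln x$ of the minimizing function is a
supergradient.  This gives its derivative without differentiating under the integral.
\<close>
definition legendre :: "real \<Rightarrow> real" where
  "legendre u = (LINT t|M. ln (1 + smoothed_atom_inv u * t)) - (1 - u) * ln (smoothed_atom_inv u)"

lemma integrable_ln_kernel:
  assumes "0 < x" shows "integrable M (\<lambda>t. ln (1 + x * t))"
proof (rule integrable_bounded)
  fix t assume "a \<le> t" "t \<le> b"
  then have "1 \<le> 1 + x * t" "1 + x * t \<le> 1 + x * b" using assms a_pos by auto
  then show "\<bar>ln (1 + x * t)\<bar> \<le> ln (1 + x * b)" by simp
qed simp

lemma legendre_supergradient:
  assumes u: "u \<in> {0<..<1}" and v: "v \<in> {0<..<1}"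
  shows "legendre v \<le> legendre u + (v - u) * ln (smoothed_atom_inv u)"
proof -
  note pu = smoothed_atom_inv(1)[OF u] and pv = smoothed_atom_inv(1)[OF v]
  have "(LINT t|M. ln (1 + smoothed_atom_inv v * t) + (ln (smoothed_atom_inv u) - ln (smoothed_atom_inv v)) * (1 - 1 / (1 + smoothed_atom_inv v * t)))
      \<le> (LINT t|M. ln (1 + smoothed_atom_inv u * t))"
  proof (intro integral_mono_AE Bochner_Integration.integrable_add integrable_mult_right
      Bochner_Integration.integrable_diff integrable_kernel integrable_ln_kernel pu pv)
    show "AE t in M. ln (1 + smoothed_atom_inv v * t) + (ln (smoothed_atom_inv u) - ln (smoothed_atom_inv v)) * (1 - 1 / (1 + smoothed_atom_inv v * t))
        \<le> ln (1 + smoothed_atom_inv u * t)"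
      using AE_nonneg by eventually_elim (intro ln_weighted_bound pu pv)
  qed simp
  also have "(LINT t|M. ln (1 + smoothed_atom_inv v * t) + (ln (smoothed_atom_inv u) - ln (smoothed_atom_inv v)) * (1 - 1 / (1 + smoothed_atom_inv v * t)))
     = (LINT t|M. ln (1 + smoothed_atom_inv v * t)) + (ln (smoothed_atom_inv u) - ln (smoothed_atom_inv v)) * (1 - smoothed_atom M (smoothed_atom_inv v))"
    using integrable_kernel[OF pv] integrable_ln_kernel[OF pv] prob_space
    by (simp add: smoothed_atom_def)
  finally show ?thesis unfolding legendre_def smoothed_atom_inv(2)[OF v] by (simp add: algebra_simps)
qed

text \<open>
Adding the primitive $u \ln u + (1-u) \ln(1-u)$ of $\ln u - \ln(1-u)$ to the function
\<open>legendre\<close> produces a primitive of minus the logarithm of the quantile (see \<open>log_primitive_eq\<close>).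
In the form given here its boundary values can be read off: $\int \ln t\,M(\mathrm{d}t)$
at $u = 0$ and $0$ at $u = 1$.
\<close>
definition log_primitive :: "real \<Rightarrow> real" where
  "log_primitive u = (LINT t|M. ln (u * Phi_quantile M u + (1 - u) * t)) - u * ln (Phi_quantile M u)"

lemma integrable_ln_mix:
  assumes "u \<in> {0<..<1}"
  shows "integrable M (\<lambda>t. ln (u * Phi_quantile M u + (1 - u) * t))"
proof (rule integrable_bounded)
  fix t assume "a \<le> t" "t \<le> b"
  then have "u * Phi_quantile M u + (1 - u) * t \<in> {a..b}"
    using Phi_quantile_bounds[OF assms] assms
      convexD_alt[of "{a..b}" "t" "Phi_quantile M u" u] by (simp add: add.commute)
  then show "\<bar>ln (u * Phi_quantile M u + (1 - u) * t)\<bar> \<le> \<bar>ln a\<bar> + \<bar>ln b\<bar>"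
    using a_pos by (intro abs_ln_le) auto
qed simp

lemma log_primitive_eq:
  assumes u: "u \<in> {0<..<1}"
  shows "log_primitive u = legendre u + (u * ln u + (1 - u) * ln (1 - u))"
proof -
  let ?q = "Phi_quantile M u"
  have q: "0 < ?q" by (rule Phi_quantile_root(1)[OF u])
  have "(LINT t|M. ln (u * ?q + (1 - u) * t)) = (LINT t|M. ln u + ln ?q + ln (1 + smoothed_atom_inv u * t))"
  proof (intro integral_cong_AE)
    show "AE t in M. ln (u * ?q + (1 - u) * t) = ln u + ln ?q + ln (1 + smoothed_atom_inv u * t)"
      using AE_nonneg
    proof eventually_elim
      fix t :: real assume t: "0 \<le> t"
      have "u * ?q + (1 - u) * t = u * ?q * (1 + smoothed_atom_inv u * t)"
      proof -
        have "smoothed_atom_inv u * (u * ?q) = 1 - u" using u q by (simp add: smoothed_atom_inv_def)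
        moreover have "u * ?q * (1 + smoothed_atom_inv u * t) = u * ?q + (smoothed_atom_inv u * (u * ?q)) * t"
          by (simp add: algebra_simps)
        ultimately show ?thesis by simp
      qed
      then show "ln (u * ?q + (1 - u) * t) = ln u + ln ?q + ln (1 + smoothed_atom_inv u * t)"
        using u q kernel_bounds(3)[OF t smoothed_atom_inv(1)[OF u]] by (simp add: ln_mult)
    qed
  qed auto
  also have "\<dots> = ln u + ln ?q + (LINT t|M. ln (1 + smoothed_atom_inv u * t))"
    using integrable_ln_kernel[OF smoothed_atom_inv(1)[OF u]] prob_space by simp
  finally show ?thesis unfolding log_primitive_def legendre_def ln_smoothed_atom_inv[OF u]
    by (simp add: algebra_simps)
qed

lemma log_primitive_deriv:
  assumes u: "u \<in> {0<..<1}"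
  shows "(log_primitive has_real_derivative - ln (Phi_quantile M u)) (at u)"
proof -
  have 1: "(legendre has_real_derivative ln (smoothed_atom_inv u)) (at u)"
  proof (rule has_real_derivative_of_supergradient[where S = "{0<..<1}" and g = "\<lambda>u. ln (smoothed_atom_inv u)"])
    show "isCont (\<lambda>u. ln (smoothed_atom_inv u)) u"
      using isCont_smoothed_atom_inv[OF u] smoothed_atom_inv(1)[OF u] by (intro continuous_intros) auto
    show "legendre v \<le> legendre w + (v - w) * ln (smoothed_atom_inv w)" if "v \<in> {0<..<1}" "w \<in> {0<..<1}" for v w
      using legendre_supergradient[OF that(2,1)] .
  qed (use u in auto)
  have 2: "((\<lambda>u. u * ln u + (1 - u) * ln (1 - u)) has_real_derivative ln u - ln (1 - u)) (at u)"
    using u by (auto intro!: derivative_eq_intros)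
  have "((\<lambda>u. legendre u + (u * ln u + (1 - u) * ln (1 - u))) has_real_derivative
      - ln (Phi_quantile M u)) (at u)"
    using DERIV_add[OF 1 2] unfolding ln_smoothed_atom_inv[OF u] by (simp add: algebra_simps)
  then show ?thesis
    by (rule has_field_derivative_transform_within_open[where S = "{0<..<1}"])
       (use u in \<open>simp_all add: log_primitive_eq\<close>)
qed

lemma log_primitive_bounds:
  assumes u: "u \<in> {0<..<1}"
  shows "\<bar>log_primitive u - (LINT t|M. ln t)\<bar> \<le> u * ((b - a) / a + (\<bar>ln a\<bar> + \<bar>ln b\<bar>))"
    and "\<bar>log_primitive u\<bar> \<le> (1 - u) * ((b - a) / a + (\<bar>ln a\<bar> + \<bar>ln b\<bar>))"
proof -
  let ?q = "Phi_quantile M u"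
  have q: "a \<le> ?q" "?q \<le> b" using Phi_quantile_bounds[OF u] by auto
  have lnq: "\<bar>ln ?q\<bar> \<le> \<bar>ln a\<bar> + \<bar>ln b\<bar>" using q a_pos by (intro abs_ln_le)
  have mix: "a \<le> u * ?q + (1 - u) * t" if "a \<le> t" for t
    using convexD_alt[of "{a..}" t ?q u] that q u by (simp add: add.commute)
  have "\<bar>(LINT t|M. ln (u * ?q + (1 - u) * t)) - (LINT t|M. ln t)\<bar> \<le> u * ((b - a) / a)"
  proof (rule integral_diff_bound[OF integrable_ln_mix[OF u] integrable_ln])
    fix t assume t: "a \<le> t" "t \<le> b"
    have "\<bar>ln (u * ?q + (1 - u) * t) - ln t\<bar> \<le> \<bar>u * ?q + (1 - u) * t - t\<bar> / a"
      using t a_pos mix by (intro abs_ln_diff_le)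
    also have "u * ?q + (1 - u) * t - t = u * (?q - t)" by (simp add: algebra_simps)
    also have "\<bar>u * (?q - t)\<bar> / a = u * (\<bar>?q - t\<bar> / a)"
      using u by (simp add: abs_mult)
    also have "\<dots> \<le> u * ((b - a) / a)"
      using u q t a_pos by (intro mult_left_mono divide_right_mono) auto
    finally show "\<bar>ln (u * ?q + (1 - u) * t) - ln t\<bar> \<le> u * ((b - a) / a)" .
  qed
  moreover have "\<bar>u * ln ?q\<bar> \<le> u * (\<bar>ln a\<bar> + \<bar>ln b\<bar>)"
    using lnq u by (simp add: abs_mult)
  ultimately show "\<bar>log_primitive u - (LINT t|M. ln t)\<bar> \<le> u * ((b - a) / a + (\<bar>ln a\<bar> + \<bar>ln b\<bar>))"
    unfolding log_primitive_def distrib_left[of u "(b - a) / a"] by linarith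
  have "\<bar>(LINT t|M. ln (u * ?q + (1 - u) * t)) - (LINT t|M. ln ?q)\<bar> \<le> (1 - u) * ((b - a) / a)"
  proof (rule integral_diff_bound[OF integrable_ln_mix[OF u]])
    fix t assume t: "a \<le> t" "t \<le> b"
    have "\<bar>ln (u * ?q + (1 - u) * t) - ln ?q\<bar> \<le> \<bar>u * ?q + (1 - u) * t - ?q\<bar> / a"
      using t q a_pos mix by (intro abs_ln_diff_le)
    also have "u * ?q + (1 - u) * t - ?q = (1 - u) * (t - ?q)" by (simp add: algebra_simps)
    also have "\<bar>(1 - u) * (t - ?q)\<bar> / a = (1 - u) * (\<bar>t - ?q\<bar> / a)"
      using u by (simp add: abs_mult)
    also have "\<dots> \<le> (1 - u) * ((b - a) / a)"
      using u q t a_pos by (intro mult_left_mono divide_right_mono) auto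
    finally show "\<bar>ln (u * ?q + (1 - u) * t) - ln ?q\<bar> \<le> (1 - u) * ((b - a) / a)" .
  qed simp
  moreover have "(LINT t|M. ln ?q) = ln ?q" using prob_space by simp
  moreover have "\<bar>(1 - u) * ln ?q\<bar> \<le> (1 - u) * (\<bar>ln a\<bar> + \<bar>ln b\<bar>)"
    using lnq u by (simp add: abs_mult)
  moreover have "u * ln ?q = ln ?q - (1 - u) * ln ?q" by (simp add: algebra_simps)
  ultimately show "\<bar>log_primitive u\<bar> \<le> (1 - u) * ((b - a) / a + (\<bar>ln a\<bar> + \<bar>ln b\<bar>))"
    unfolding log_primitive_def distrib_left[of "1 - u" "(b - a) / a"] by linarith
qed

lemma borel_measurable_Phi_quantile:
  "Phi_quantile M \<in> borel_measurable (restrict_space borel {0<..<1})"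
  by (intro borel_measurable_continuous_on_restrict continuous_at_imp_continuous_on ballI
      isCont_Phi_quantile)

lemma set_integrable_ln_Phi_quantile:
  "set_integrable lborel {0<..<1} (\<lambda>u. ln (Phi_quantile M u))"
proof -
  have m: "(\<lambda>u. ln (Phi_quantile M u)) \<in> borel_measurable (restrict_space borel {0<..<1})"
    using borel_measurable_Phi_quantile by measurable
  show ?thesis
  proof (rule set_integrable_bound)
    show "set_integrable lborel {0<..<1::real} (\<lambda>u. \<bar>ln a\<bar> + \<bar>ln b\<bar>)"
      by (simp add: set_integrable_def)
    show "set_borel_measurable lborel {0<..<1} (\<lambda>u. ln (Phi_quantile M u))"
      using m by (simp add: set_borel_measurable_def borel_measurable_restrict_space_iff)
    have "\<bar>ln (Phi_quantile M u)\<bar> \<le> \<bar>ln a\<bar> + \<bar>ln b\<bar>" if "u \<in> {0<..<1}" for u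
      using Phi_quantile_bounds[OF that] a_pos by (intro abs_ln_le) auto
    then show "AE u in lborel. u \<in> {0<..<1} \<longrightarrow>
        norm (ln (Phi_quantile M u)) \<le> norm (\<bar>ln a\<bar> + \<bar>ln b\<bar>)"
      by (intro AE_I2) simp
  qed
qed

text \<open>
The formula $-\int_0^1 \ln S_M(u-1)\,\mathrm{d}u = \int \ln t\,M(\mathrm{d}t)$ of Haagerup and
Moeller, for measures supported away from $0$ and $\infty$.
\<close>
lemma integral_ln_Phi_quantile:
  "(LBINT u:{0<..<1}. ln (Phi_quantile M u)) = (LINT t|M. ln t)"
proof -
  let ?C = "(b - a) / a + (\<bar>ln a\<bar> + \<bar>ln b\<bar>)"
  have "(LBINT u=ereal 0..ereal 1. - ln (Phi_quantile M u)) = 0 - (LINT t|M. ln t)"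
  proof (rule interval_integral_FTC_integrable[where F = log_primitive])
    show "set_integrable lborel (einterval (ereal 0) (ereal 1)) (\<lambda>u. - ln (Phi_quantile M u))"
      using set_integrable_ln_Phi_quantile by (simp add: set_integrable_def)
    have "eventually (\<lambda>u::real. u \<in> {0<..<1}) (at_right 0)"
      by (rule eventually_at_right_real) simp
    then have "eventually (\<lambda>u. norm (log_primitive u - (LINT t|M. ln t)) \<le> u * ?C) (at_right 0)"
      by (rule eventually_mono) (use log_primitive_bounds(1) in auto)
    moreover have "((\<lambda>u. u * ?C) \<longlongrightarrow> 0 * ?C) (at_right 0)" by (intro tendsto_intros)
    then have "((\<lambda>u. u * ?C) \<longlongrightarrow> 0) (at_right 0)" by simp
    ultimately have "((\<lambda>u. log_primitive u - (LINT t|M. ln t)) \<longlongrightarrow> 0) (at_right 0)"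
      by (rule Lim_null_comparison)
    then have "(log_primitive \<longlongrightarrow> (LINT t|M. ln t)) (at_right 0)" by (rule LIM_zero_cancel)
    then show "((log_primitive \<circ> real_of_ereal) \<longlongrightarrow> (LINT t|M. ln t)) (at_right (ereal 0))"
      by (simp only: ereal_tendsto_simps)
    have "eventually (\<lambda>u::real. u \<in> {0<..<1}) (at_left 1)"
      by (rule eventually_at_left_real) simp
    then have "eventually (\<lambda>u. norm (log_primitive u) \<le> (1 - u) * ?C) (at_left 1)"
      by (rule eventually_mono) (use log_primitive_bounds(2) in auto)
    moreover have "((\<lambda>u. (1 - u) * ?C) \<longlongrightarrow> (1 - 1) * ?C) (at_left 1)" by (intro tendsto_intros)
    then have "((\<lambda>u. (1 - u) * ?C) \<longlongrightarrow> 0) (at_left 1)" by simp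
    ultimately have "(log_primitive \<longlongrightarrow> 0) (at_left 1)"
      by (rule Lim_null_comparison)
    then show "((log_primitive \<circ> real_of_ereal) \<longlongrightarrow> 0) (at_left (ereal 1))"
      by (simp only: ereal_tendsto_simps)
  next
    fix u :: real assume "ereal 0 < ereal u" "ereal u < ereal 1"
    then have u: "u \<in> {0<..<1}" by simp
    show "(log_primitive has_vector_derivative - ln (Phi_quantile M u)) (at u)"
      using log_primitive_deriv[OF u] by (simp add: has_real_derivative_iff_has_vector_derivative)
    show "isCont (\<lambda>u. - ln (Phi_quantile M u)) u"
      using isCont_Phi_quantile[OF u] Phi_quantile_root(1)[OF u] by (intro continuous_intros) auto
  qed simp
  then show ?thesis
    by (simp add: interval_integral_Ioo set_lebesgue_integral_def)
qed

end

section \<open>Quantiles of weak limits\<close>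

text \<open>
Weak convergence gives pointwise convergence of distribution functions at continuity points only; but
these are dense, since the discontinuities are the countably many atoms.
\<close>
lemma weak_conv_m_cdf_between:
  assumes L: "real_distribution L" and conv: "weak_conv_m N L" and "x < y"
  obtains z where "x < z" "z < y" "(\<lambda>n. cdf (N n) z) \<longlonglongrightarrow> cdf L z"
proof -
  interpret L: real_distribution L by fact
  have "\<not> {x<..<y} \<subseteq> {z. 0 < measure L {z}}"
    using countable_subset[OF _ L.countable_atoms] uncountable_open_interval[of x y] \<open>x < y\<close>
    by blast
  then obtain z where z: "x < z" "z < y" "\<not> 0 < measure L {z}"
    unfolding subset_iff mem_Collect_eq greaterThanLessThan_iff by blast
  then have "measure L {z} = 0" by (simp add: zero_less_measure_iff)
  then have "isCont (cdf L) z" by (simp add: L.isCont_cdf)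
  then have "(\<lambda>n. cdf (N n) z) \<longlonglongrightarrow> cdf L z"
    using conv by (auto simp: weak_conv_m_def weak_conv_def)
  with z show ?thesis by (intro that)
qed

text \<open>
For large \<open>n\<close> the kernel $s \mapsto 1/(1 + c\,(s/q)^n)$ is close to the indicator of $[0, q)$; the
first two bounds compare it with the indicator of $[0, z]$, usefully for $z < q$ and $z > q$
respectively.
\<close>
lemma sharp_kernel_bounds:
  fixes s z q c :: real
  assumes "0 \<le> s" "0 < z" "0 < q" "0 < c"
  shows "indicator {..z} s * (1 / (1 + c * (z / q) ^ n)) \<le> 1 / (1 + c * (s / q) ^ n)"
    and "1 / (1 + c * (s / q) ^ n) \<le> indicator {..z} s + 1 / (1 + c * (z / q) ^ n)"
    and "\<bar>1 / (1 + c * (s / q) ^ n)\<bar> \<le> 1"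
proof -
  have nonneg: "0 \<le> c * (s / q) ^ n" "0 \<le> c * (z / q) ^ n"
    using assms by (intro mult_nonneg_nonneg zero_le_power divide_nonneg_pos; simp)+
  then have p: "0 < 1 + c * (s / q) ^ n" "0 < 1 + c * (z / q) ^ n" by linarith+
  show abs_le: "\<bar>1 / (1 + c * (s / q) ^ n)\<bar> \<le> 1"
    using nonneg(1) p(1) by (simp add: abs_of_pos divide_le_eq)
  then have le: "1 / (1 + c * (s / q) ^ n) \<le> 1" by linarith
  show "indicator {..z} s * (1 / (1 + c * (z / q) ^ n)) \<le> 1 / (1 + c * (s / q) ^ n)"
  proof (cases "s \<le> z")
    case True
    then have "c * (s / q) ^ n \<le> c * (z / q) ^ n"
      using assms by (intro mult_left_mono power_mono divide_right_mono) auto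
    then show ?thesis using True p by (simp add: frac_le)
  qed (use p in simp)
  show "1 / (1 + c * (s / q) ^ n) \<le> indicator {..z} s + 1 / (1 + c * (z / q) ^ n)"
  proof (cases "s \<le> z")
    case True
    have "0 \<le> 1 / (1 + c * (z / q) ^ n)" using p(2) by (intro divide_nonneg_pos) auto
    moreover have "indicator {..z} s = (1 :: real)" using True by simp
    ultimately show ?thesis using le by linarith
  next
    case False
    then have "c * (z / q) ^ n \<le> c * (s / q) ^ n"
      using assms by (intro mult_left_mono power_mono divide_right_mono) auto
    then show ?thesis using False p by (simp add: frac_le)
  qed
qed

text \<open>
The constancy in \<open>n\<close> of the integrals of the sharpening kernels forces the limit law to have \<open>q\<close> as a
\<open>u\<close>-quantile.
\<close>
lemma weak_limit_quantile:
  assumes N: "\<And>n. real_distribution (N n)" "\<And>n. AE s in N n. 0 \<le> s"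
    and L: "real_distribution L" and conv: "weak_conv_m N L"
    and q: "0 < q" and c: "0 < c"
    and eq: "\<And>n. n \<ge> 1 \<Longrightarrow> (LINT s|N n. 1 / (1 + c * (s / q) ^ n)) = u"
  shows "y < q \<Longrightarrow> cdf L y \<le> u" and "q < y \<Longrightarrow> u \<le> cdf L y"
proof -
  interpret L: real_distribution L by fact
  define k where "k z n = 1 / (1 + c * (z / q) ^ n)" for z :: real and n
  have bounds: "cdf (N n) z * k z n \<le> u" "u \<le> cdf (N n) z + k z n" if n: "n \<ge> 1" and z: "0 < z" for n z
  proof -
    interpret real_distribution "N n" by fact
    have ind: "cdf (N n) z = (LINT s|N n. indicator {..z} s)" by (simp add: cdf_def)
    have int: "integrable (N n) (indicator {..z} :: real \<Rightarrow> real)"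
      by (rule integrable_const_bound[where B = 1]) (auto simp: indicator_def)
    have int': "integrable (N n) (\<lambda>s. k s n)"
    proof (rule integrable_const_bound[where B = 1])
      show "AE s in N n. norm (k s n) \<le> 1" using N(2)
        unfolding k_def real_norm_def by eventually_elim (intro sharp_kernel_bounds(3)[OF _ q q c])
    qed (simp add: k_def)
    have eq': "(LINT s|N n. k s n) = u" using eq[OF n] by (simp add: k_def)
    have "(LINT s|N n. indicator {..z} s * k z n) \<le> (LINT s|N n. k s n)"
    proof (intro integral_mono_AE int' integrable_mult_left int)
      show "AE s in N n. indicator {..z} s * k z n \<le> k s n" using N(2)
        unfolding k_def by eventually_elim (intro sharp_kernel_bounds(1) z q c)
    qed
    then show "cdf (N n) z * k z n \<le> u" using int by (simp add: ind eq')
    have "(LINT s|N n. k s n) \<le> (LINT s|N n. indicator {..z} s + k z n)"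
    proof (intro integral_mono_AE int' Bochner_Integration.integrable_add int)
      show "AE s in N n. k s n \<le> indicator {..z} s + k z n" using N(2)
        unfolding k_def by eventually_elim (intro sharp_kernel_bounds(2) z q c)
    qed simp
    then show "u \<le> cdf (N n) z + k z n" using int prob_space by (simp add: ind eq')
  qed
  show "cdf L y \<le> u" if "y < q"
  proof -
    have "max y 0 < q" using that q by simp
    then obtain z where z: "max y 0 < z" "z < q" "(\<lambda>n. cdf (N n) z) \<longlonglongrightarrow> cdf L z"
      by (rule weak_conv_m_cdf_between[OF L conv])
    have "norm (z / q) < 1" using z q by (simp add: abs_of_pos)
    then have pow: "(\<lambda>n. (z / q) ^ n) \<longlonglongrightarrow> 0" by (rule LIMSEQ_power_zero)
    have "(\<lambda>n. cdf (N n) z * k z n) \<longlonglongrightarrow> cdf L z * (1 / (1 + c * 0))"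
      unfolding k_def
      by (intro tendsto_mult[OF z(3)] tendsto_divide tendsto_add tendsto_mult tendsto_const pow) auto
    then have "cdf L z * (1 / (1 + c * 0)) \<le> u"
      by (rule LIMSEQ_le_const2) (use bounds(1) z in \<open>auto intro!: exI[of _ 1]\<close>)
    moreover have "cdf L y \<le> cdf L z" using z by (intro L.cdf_nondecreasing) simp
    ultimately show ?thesis by simp
  qed
  show "u \<le> cdf L y" if "q < y"
  proof -
    obtain z where z: "q < z" "z < y" "(\<lambda>n. cdf (N n) z) \<longlonglongrightarrow> cdf L z"
      using weak_conv_m_cdf_between[OF L conv \<open>q < y\<close>] .
    have "filterlim (\<lambda>n. (z / q) ^ n) at_infinity sequentially"
      using z q by (intro filterlim_realpow_sequentially_gt1) (simp add: abs_of_pos)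
    then have "k z \<longlonglongrightarrow> 0" unfolding k_def using c
      by (intro tendsto_divide_0[OF tendsto_const]
          tendsto_add_filterlim_at_infinity[OF tendsto_const]
          tendsto_mult_filterlim_at_infinity[OF tendsto_const]) auto
    then have "(\<lambda>n. cdf (N n) z + k z n) \<longlonglongrightarrow> cdf L z + 0" by (intro tendsto_add z(3))
    then have "u \<le> cdf L z + 0"
      by (rule LIMSEQ_le_const) (use bounds(2) z q in \<open>auto intro!: exI[of _ 1]\<close>)
    moreover have "cdf L z \<le> cdf L y" using z by (intro L.cdf_nondecreasing) simp
    ultimately show ?thesis by simp
  qed
qed

lemma real_distribution_pushforward_powr:
  assumes "real_distribution N" shows "real_distribution (pushforward_powr N \<alpha>)"
proof -
  interpret real_distribution N by fact
  have "prob_space (distr N borel (\<lambda>x. x powr \<alpha>))" by (rule prob_space_distr) simp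
  then show ?thesis
    by (simp add: pushforward_powr_def real_distribution_def real_distribution_axioms_def)
qed

text \<open>
The quantiles of \<open>L\<close> at a level \<open>u\<close> form an interval if the distribution function equals \<open>u\<close>
on an interval.  Any choice of quantiles still transports the uniform
distribution on $(0,1)$ to \<open>L\<close>, as $\{u.\ Q\,u \le y\}$ agrees with $(0, F(y)]$ up to the end
point.
\<close>
lemma distr_quantile:
  fixes Q :: "real \<Rightarrow> real"
  assumes L: "real_distribution L"
    and Q[measurable]: "Q \<in> borel_measurable (restrict_space borel {0<..<1})"
    and below: "\<And>u y. u \<in> {0<..<1} \<Longrightarrow> y < Q u \<Longrightarrow> cdf L y \<le> u"
    and above: "\<And>u y. u \<in> {0<..<1} \<Longrightarrow> Q u < y \<Longrightarrow> u \<le> cdf L y"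
  shows "distr (restrict_space lborel {0<..<1}) borel Q = L"
proof (rule cdf_unique[OF _ L], rule_tac [2] ext)
  interpret L: real_distribution L by fact
  let ?U = "restrict_space lborel {0<..<1::real}"
  interpret U: prob_space ?U
    by (auto simp add: emeasure_restrict_space space_restrict_space intro!: prob_spaceI)
  have Q': "Q \<in> borel_measurable ?U"
    using Q by (subst measurable_cong_sets[OF sets_restrict_space_cong[OF sets_lborel] refl])
  show "real_distribution (distr ?U borel Q)"
    using U.prob_space_distr[OF Q'] by (simp add: real_distribution_def real_distribution_axioms_def)
  fix y
  let ?A = "{u \<in> {0<..<1}. Q u \<le> y}"
  have F: "0 \<le> cdf L y" "cdf L y \<le> 1" by (auto simp: L.cdf_nonneg L.cdf_bounded_prob)
  have sub1: "{0<..<cdf L y} \<subseteq> ?A"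
  proof
    fix u assume "u \<in> {0<..<cdf L y}"
    then have u: "u \<in> {0<..<1}" "u < cdf L y" using F by auto
    have "\<not> y < Q u" using below[OF u(1), of y] u(2) by linarith
    then show "u \<in> ?A" using u by simp
  qed
  have sub2: "?A \<subseteq> {0..cdf L y}"
  proof
    fix u assume u: "u \<in> ?A"
    have "((cdf L) \<longlongrightarrow> cdf L y) (at_right y)"
      using L.cdf_is_right_cont[of y] by (simp add: continuous_within)
    moreover have "eventually (\<lambda>z. u \<le> cdf L z) (at_right y)"
      using eventually_at_right_less[of y] by eventually_elim (use u above in auto)
    ultimately have "u \<le> cdf L y" by (intro tendsto_lowerbound) auto
    then show "u \<in> {0..cdf L y}" using u by simp
  qed
  have vimage: "?A = Q -` {..y} \<inter> space ?U" by (auto simp: space_restrict_space)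
  have "?A \<in> sets ?U" unfolding vimage by (rule measurable_sets[OF Q']) simp
  then have A: "?A \<in> sets lborel" by (simp add: sets_restrict_space_iff)
  have "cdf (distr ?U borel Q) y = measure ?U ?A"
    unfolding cdf_def vimage by (rule measure_distr[OF Q']) simp
  also have "\<dots> = measure lborel ?A"
    by (intro measure_restrict_space) auto
  also have "\<dots> = cdf L y"
  proof (rule antisym)
    have Icc: "{0..cdf L y} \<in> fmeasurable lborel" by (intro fmeasurableI) (use F in auto)
    have "measure lborel ?A \<le> measure lborel {0..cdf L y}"
      using sub2 A Icc by (rule measure_mono_fmeasurable)
    then show "measure lborel ?A \<le> cdf L y" using F by simp
    have "?A \<in> fmeasurable lborel"
      by (rule fmeasurableI2[OF Icc sub2 A])
    then have "measure lborel {0<..<cdf L y} \<le> measure lborel ?A"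
      using sub1 by (intro measure_mono_fmeasurable) auto
    then show "cdf L y \<le> measure lborel ?A" using F by simp
  qed
  finally show "cdf (distr ?U borel Q) y = cdf L y" .
qed

section \<open>The limit of the roots of the free powers\<close>

context bounded_law
begin

lemma S_transform_bounds:
  assumes "u \<in> {0<..<1}" shows "0 < S_transform M (u - 1)" "S_transform M (u - 1) \<le> 1 / a"
proof -
  show p: "0 < S_transform M (u - 1)"
    using smoothed_atom_S_transform[of u] assms no_atom by simp
  show "S_transform M (u - 1) \<le> 1 / a"
    using Phi_quantile_bounds[OF assms] p a_pos by (simp add: Phi_quantile_def field_simps)
qed

text \<open>
Boundedness of $S_M$ carries over to its powers, so by \<open>free_mult_conv_bounded_S\<close> no atom at 0
can appear along the induction, and all S-transforms stay defined on the whole of $(-1, 0)$.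
\<close>
lemma free_mult_powers_S_transform:
  assumes P: "free_mult_powers M P" and M: "prob_measure_on {0..} M" and "n \<ge> 1"
  shows "prob_measure_on {0..} (P n) \<and> measure (P n) {0} = 0 \<and>
    (\<forall>u\<in>{0<..<1}. S_transform (P n) (u - 1) = S_transform M (u - 1) ^ n)"
  using \<open>n \<ge> 1\<close>
proof (induction n rule: dec_induct)
  case base
  then show ?case using P M no_atom by (simp add: free_mult_powers_def)
next
  case (step n)
  have conv: "is_free_mult_conv (P n) M (P (Suc n))"
    using P step.hyps by (simp add: free_mult_powers_def)
  have IH: "measure (P n) {0} = 0"
      "\<And>u. u \<in> {0<..<1} \<Longrightarrow> S_transform (P n) (u - 1) = S_transform M (u - 1) ^ n"
    using step.IH by auto
  have bound: "S_transform (P n) (u - 1) * S_transform M (u - 1) \<le> (1 / a) ^ Suc n"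
    if "u \<in> {0<..<1}" for u
  proof -
    have "S_transform (P n) (u - 1) * S_transform M (u - 1) = S_transform M (u - 1) ^ Suc n"
      using IH(2)[OF that] by simp
    also have "\<dots> \<le> (1 / a) ^ Suc n"
      using S_transform_bounds[OF that] by (intro power_mono) auto
    finally show ?thesis .
  qed
  note L = free_mult_conv_bounded_S[OF conv IH(1) no_atom bound]
  have "prob_measure_on {0..} (P (Suc n))" using conv by (simp add: is_free_mult_conv_def)
  moreover have "measure (P (Suc n)) {0} = 0" by (rule L(1))
  moreover have "S_transform (P (Suc n)) (u - 1) = S_transform M (u - 1) ^ Suc n"
    if "u \<in> {0<..<1}" for u
    using L(2)[OF _ that] IH(2)[OF that] by simp
  ultimately show ?case by blast
qed

text \<open>
The equation \<open>smoothed_atom (P n) x = u\<close> with $x = \frac{1-u}{u} S_M(u-1)^n$, after the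
substitution $t = s^n$.
\<close>
lemma pushforward_kernel_integral:
  assumes P: "free_mult_powers M P" and M: "prob_measure_on {0..} M" and n: "n \<ge> 1"
    and u: "u \<in> {0<..<1}"
  shows "(LINT s|pushforward_powr (P n) (1 / real n).
      1 / (1 + (1 - u) / u * (s / Phi_quantile M u) ^ n)) = u"
proof -
  have Pn: "prob_measure_on {0..} (P n)" "measure (P n) {0} = 0"
      "S_transform (P n) (u - 1) = S_transform M (u - 1) ^ n"
    using free_mult_powers_S_transform[OF P M n] u by auto
  interpret Pn: nonneg_law "P n" using Pn(1) by (rule prob_measure_on_nonneg_law)
  let ?x = "(1 - u) / u * S_transform M (u - 1) ^ n"
  have [measurable]: "(\<lambda>x::real. x powr (1 / real n)) \<in> borel_measurable (P n)" by simp
  have "(LINT s|pushforward_powr (P n) (1 / real n).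
      1 / (1 + (1 - u) / u * (s / Phi_quantile M u) ^ n))
    = (LINT t|P n. 1 / (1 + (1 - u) / u * ((t powr (1 / real n)) / Phi_quantile M u) ^ n))"
    unfolding pushforward_powr_def by (intro integral_distr) auto
  also have "\<dots> = (LINT t|P n. 1 / (1 + ?x * t))"
  proof (intro integral_cong_AE)
    show "AE t in P n. 1 / (1 + (1 - u) / u * ((t powr (1 / real n)) / Phi_quantile M u) ^ n)
        = 1 / (1 + ?x * t)"
      using Pn.AE_nonneg
    proof eventually_elim
      fix t :: real assume t: "0 \<le> t"
      have "(t powr (1 / real n)) ^ n = t"
        using t n by (cases "t = 0") (auto simp: powr_power)
      then have "((t powr (1 / real n)) / Phi_quantile M u) ^ n = S_transform M (u - 1) ^ n * t"
        by (simp add: Phi_quantile_def power_mult_distrib)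
      then show "1 / (1 + (1 - u) / u * ((t powr (1 / real n)) / Phi_quantile M u) ^ n)
        = 1 / (1 + ?x * t)" by simp
    qed
  qed auto
  also have "\<dots> = u"
    using Pn.smoothed_atom_S_transform(2)[of u] Pn u by (simp add: smoothed_atom_def)
  finally show ?thesis .
qed

lemma Phi_eq_distr_quantile:
  assumes "is_Phi M L"
  shows "distr (restrict_space lborel {0<..<1}) borel (Phi_quantile M) = L"
proof -
  obtain P where M: "prob_measure_on {0..} M" and L: "prob_measure_on {0..} L"
    and P: "free_mult_powers M P"
    and conv: "weak_conv_m (\<lambda>n. pushforward_powr (P n) (1 / real n)) L"
    using assms unfolding is_Phi_def by blast
  have L': "real_distribution L" using L by (simp add: prob_measure_on_def)
  \<comment> \<open>\<open>P 0\<close> is arbitrary and need not be a probability measure, hence the default \<open>L\<close>\<close>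
  define N where "N n = (if n = 0 then L else pushforward_powr (P n) (1 / real n))" for n
  have PN: "prob_measure_on {0..} (P n)" if "n \<ge> 1" for n
    using free_mult_powers_S_transform[OF P M that] by blast
  have N: "real_distribution (N n)" for n
    using L' PN[of n] by (auto simp: N_def prob_measure_on_def intro: real_distribution_pushforward_powr)
  have AE: "AE s in N n. 0 \<le> s" for n
  proof (cases "n = 0")
    case True
    interpret L: nonneg_law L using L by (rule prob_measure_on_nonneg_law)
    have "N n = L" using True by (simp add: N_def)
    then show ?thesis using L.AE_nonneg by metis
  next
    case False
    then interpret Pn: nonneg_law "P n" by (intro prob_measure_on_nonneg_law PN) simp
    show ?thesis using False unfolding N_def pushforward_powr_def by (simp add: AE_distr_iff)
  qed
  have "eventually (\<lambda>n. pushforward_powr (P n) (1 / real n) = N n) sequentially"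
    using eventually_gt_at_top[of 0] by eventually_elim (simp add: N_def)
  then have "eventually (\<lambda>n. cdf (pushforward_powr (P n) (1 / real n)) x = cdf (N n) x) sequentially" for x
    by eventually_elim simp
  then have conv': "weak_conv_m N L"
    using conv by (auto simp: weak_conv_m_def weak_conv_def elim!: Lim_transform_eventually)
  have "cdf L y \<le> u" if "y < Phi_quantile M u" and u: "u \<in> {0<..<1}" for u y
  proof (rule weak_limit_quantile(1)[OF N AE L' conv' Phi_quantile_root(1)[OF u], where c = "(1 - u) / u"])
    show "(LINT s|N n. 1 / (1 + (1 - u) / u * (s / Phi_quantile M u) ^ n)) = u" if "n \<ge> 1" for n
      using pushforward_kernel_integral[OF P M that u] that by (simp add: N_def)
  qed (use u that in auto)
  moreover have "u \<le> cdf L y" if "Phi_quantile M u < y" and u: "u \<in> {0<..<1}" for u y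
  proof (rule weak_limit_quantile(2)[OF N AE L' conv' Phi_quantile_root(1)[OF u], where c = "(1 - u) / u"])
    show "(LINT s|N n. 1 / (1 + (1 - u) / u * (s / Phi_quantile M u) ^ n)) = u" if "n \<ge> 1" for n
      using pushforward_kernel_integral[OF P M that u] that by (simp add: N_def)
  qed (use u that in auto)
  ultimately show ?thesis
    by (intro distr_quantile L' borel_measurable_Phi_quantile) auto
qed

lemma integral_ln_Phi:
  assumes "is_Phi M L"
  shows "integrable L ln" "(LINT t|L. ln t) = (LINT t|M. ln t)"
proof -
  let ?U = "restrict_space lborel {0<..<1::real}"
  have Q: "Phi_quantile M \<in> borel_measurable ?U"
    using borel_measurable_Phi_quantile
    by (subst measurable_cong_sets[OF sets_restrict_space_cong[OF sets_lborel] refl])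
  have int: "integrable ?U (\<lambda>u. ln (Phi_quantile M u))"
    using set_integrable_ln_Phi_quantile by (simp add: integrable_restrict_space set_integrable_def)
  show "integrable L ln"
    using int unfolding Phi_eq_distr_quantile[OF assms, symmetric] by (subst integrable_distr_eq[OF Q]) auto
  have "(LINT t|L. ln t) = (LINT u|?U. ln (Phi_quantile M u))"
    unfolding Phi_eq_distr_quantile[OF assms, symmetric] by (rule integral_distr[OF Q]) simp
  also have "\<dots> = (LBINT u:{0<..<1}. ln (Phi_quantile M u))"
    by (simp add: integral_restrict_space set_lebesgue_integral_def)
  also have "\<dots> = (LINT t|M. ln t)" by (rule integral_ln_Phi_quantile)
  finally show "(LINT t|L. ln t) = (LINT t|M. ln t)" .
qed

end

section \<open>Convergence of the ratios\<close>

lemma compact_positive_in_Icc: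
  fixes K :: "real set"
  assumes "compact K" "K \<subseteq> {0..}" "0 \<notin> K" "K \<noteq> {}"
  obtains a b where "0 < a" "a \<le> b" "K \<subseteq> {a..b}"
proof -
  obtain a where a: "a \<in> K" "\<And>t. t \<in> K \<Longrightarrow> a \<le> t" using compact_attains_inf[OF assms(1,4)] by blast
  obtain b where b: "b \<in> K" "\<And>t. t \<in> K \<Longrightarrow> t \<le> b" using compact_attains_sup[OF assms(1,4)] by blast
  have "a \<noteq> 0" "0 \<le> a" using a(1) assms(2,3) by auto
  then show ?thesis using a b by (intro that[of a b]) auto
qed

theorem proposition4p2:
  fixes p :: "nat \<Rightarrow> complex poly"
    and lam :: "nat \<Rightarrow> nat \<Rightarrow> real"
    and mu :: "real measure"
    and K :: "real set"
  assumes monic: "\<And>d. d \<ge> 1 \<Longrightarrow> degree (p d) = d \<and> lead_coeff (p d) = 1"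
    and roots: "\<And>d. d \<ge> 1 \<Longrightarrow>
          proots (p d) = image_mset (\<lambda>i. complex_of_real (lam d i)) (mset_set {1..d})"
    and nonneg: "\<And>d i. d \<ge> 1 \<Longrightarrow> i \<in> {1..d} \<Longrightarrow> lam d i \<ge> 0"
    and decreasing: "\<And>d. d \<ge> 1 \<Longrightarrow> antimono_on {1..d} (lam d)"
    and K: "compact K" "K \<subseteq> {0..}"
    and mu: "prob_measure_on K mu"
    and mu_d: "\<And>d. d \<ge> 1 \<Longrightarrow> prob_measure_on K (empirical_measure d (lam d))"
    and weak: "weak_conv_m (\<lambda>d. empirical_measure d (lam d)) mu"
  shows "(\<lambda>d. R_ratio d (lam d) 1) \<longlonglongrightarrow> (LINT t|mu. t) \<and>
    (0 \<notin> K \<longrightarrow>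
      (\<lambda>d. R_ratio d (lam d) d) \<longlonglongrightarrow> inverse (LINT t|mu. inverse t) \<and>
      (\<forall>Phi_mu. is_Phi mu Phi_mu \<longrightarrow>
        integrable Phi_mu ln \<and>
        (\<lambda>d. LINT t|empirical_measure d (R_ratio d (lam d)). ln t)
          \<longlonglongrightarrow> (LINT t|Phi_mu. ln t)))"
proof (intro conjI impI allI)
  interpret mu: real_distribution mu using mu by (simp add: prob_measure_on_def)
  have Kne: "K \<noteq> {}" using mu by (auto simp: prob_measure_on_def)
  have limit: "(\<lambda>d. LINT t|empirical_measure d (lam d). f t) \<longlonglongrightarrow> (LINT t|mu. f t)"
    if "K \<subseteq> {a..b}" "continuous_on {a..b} f" "f \<in> borel_measurable borel" "a \<le> b"
    for f :: "real \<Rightarrow> real" and a b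
  proof (rule weak_conv_integral_compact[OF real_distribution_empirical_measure _ weak _ _ that(2,3,4)])
    show "real_distribution mu" ..
    show "AE t in empirical_measure d (lam d). t \<in> {a..b}" if "1 \<le> d" for d
      using prob_measure_on_AE[OF mu_d[OF that]] by eventually_elim (use \<open>K \<subseteq> {a..b}\<close> in auto)
    show "AE t in mu. t \<in> {a..b}"
      using prob_measure_on_AE[OF mu] by eventually_elim (use \<open>K \<subseteq> {a..b}\<close> in auto)
  qed
  have ev: "eventually (\<lambda>d. 1 \<le> d) sequentially" by (rule eventually_ge_at_top)

  obtain c where c: "\<And>t. t \<in> K \<Longrightarrow> t \<le> c" using compact_attains_sup[OF K(1) Kne] by blast
  have "K \<subseteq> {0..max 0 c}" using K(2) c by force
  then have "(\<lambda>d. LINT t|empirical_measure d (lam d). t) \<longlonglongrightarrow> (LINT t|mu. t)"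
    by (rule limit) auto
  moreover have "eventually (\<lambda>d. (LINT t|empirical_measure d (lam d). t) = R_ratio d (lam d) 1) sequentially"
    using ev by eventually_elim (simp add: integral_empirical_measure R_ratio_1 del: One_nat_def)
  ultimately show "(\<lambda>d. R_ratio d (lam d) 1) \<longlonglongrightarrow> (LINT t|mu. t)"
    by (rule Lim_transform_eventually)

  assume K0: "0 \<notin> K"
  obtain a b where ab: "0 < a" "a \<le> b" "K \<subseteq> {a..b}"
    using compact_positive_in_Icc[OF K K0 Kne] .
  have pos: "0 < lam d i" if "1 \<le> d" "i \<in> {1..d}" for d i
    using empirical_measure_support[OF mu_d[OF that(1)] that borel_compact[OF K(1)]] ab by auto
  interpret mu: bounded_law mu a b
  proof
    show "AE t in mu. a \<le> t \<and> t \<le> b"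
      using prob_measure_on_AE[OF mu] by eventually_elim (use ab in auto)
  qed fact

  have inv: "(\<lambda>d. LINT t|empirical_measure d (lam d). inverse t) \<longlonglongrightarrow> (LINT t|mu. inverse t)"
    by (rule limit[OF ab(3) _ _ ab(2)]) (use ab in \<open>auto intro!: continuous_intros\<close>)
  have "inverse b \<le> (LINT t|mu. inverse t)"
  proof -
    have "(LINT t|mu. inverse b) \<le> (LINT t|mu. inverse t)"
    proof (rule integral_mono_AE)
      show "AE t in mu. inverse b \<le> inverse t"
        using mu.AE_bounded by eventually_elim (use ab in \<open>auto intro: le_imp_inverse_le\<close>)
      show "integrable mu inverse"
        by (rule mu.integrable_bounded[where B = "inverse a"])
           (use ab in \<open>auto intro: le_imp_inverse_le\<close>)
    qed simp
    then show ?thesis using mu.prob_space by simp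
  qed
  then have ne: "(LINT t|mu. inverse t) \<noteq> 0" using ab by (auto simp: field_simps)
  have "eventually (\<lambda>d. inverse (LINT t|empirical_measure d (lam d). inverse t) = R_ratio d (lam d) d) sequentially"
    using ev
  proof eventually_elim
    fix d :: nat assume d: "1 \<le> d"
    show "inverse (LINT t|empirical_measure d (lam d). inverse t) = R_ratio d (lam d) d"
      using d R_ratio_top[of d "lam d"] pos[OF d] by (simp add: integral_empirical_measure)
  qed
  then show "(\<lambda>d. R_ratio d (lam d) d) \<longlonglongrightarrow> inverse (LINT t|mu. inverse t)"
    by (rule Lim_transform_eventually[OF tendsto_inverse[OF inv ne]])

  fix Phi_mu assume Phi: "is_Phi mu Phi_mu"
  show "integrable Phi_mu ln" by (rule mu.integral_ln_Phi(1)[OF Phi])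
  have "(\<lambda>d. LINT t|empirical_measure d (lam d). ln t) \<longlonglongrightarrow> (LINT t|mu. ln t)"
    by (rule limit[OF ab(3) _ _ ab(2)]) (use ab in \<open>auto intro!: continuous_intros\<close>)
  moreover have "eventually (\<lambda>d. (LINT t|empirical_measure d (lam d). ln t)
      = (LINT t|empirical_measure d (R_ratio d (lam d)). ln t)) sequentially"
    using ev
  proof eventually_elim
    fix d :: nat assume d: "1 \<le> d"
    then show "(LINT t|empirical_measure d (lam d). ln t)
        = (LINT t|empirical_measure d (R_ratio d (lam d)). ln t)"
      using sum_ln_R_ratio[of d "lam d"] pos[OF d] by (simp add: integral_empirical_measure)
  qed
  ultimately have "(\<lambda>d. LINT t|empirical_measure d (R_ratio d (lam d)). ln t) \<longlonglongrightarrow> (LINT t|mu. ln t)"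
    by (rule Lim_transform_eventually)
  then show "(\<lambda>d. LINT t|empirical_measure d (R_ratio d (lam d)). ln t) \<longlonglongrightarrow> (LINT t|Phi_mu. ln t)"
    unfolding mu.integral_ln_Phi(2)[OF Phi] .
qed

end
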